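(* Let $T=\langle \mathbf{v}_A,\mathbf{v}_B,\mathbf{v}_C\rangle\subset\mathbb{R}^2$ be a nondegenerate triangle and let $f:T\to\mathbb{R}$ be a $C^3$ function that is a polynomial of degree at most $5$ on each of the 12 subtriangles of the Powell-Sabin 12-split of $T$. Write $\mathbf{t}:=\mathbf{t}_C=\mathbf{v}_B-\mathbf{v}_A$ and $\mathbf{m}:=\mathbf{m}_C=\frac12(\mathbf{v}_A+\mathbf{v}_B)-\mathbf{v}_C$. Then the value and derivatives of $f$ at the midpoint $\mathbf{v}_{AB}$ satisfy (initialization rules) \begin{align*} f_{AB} &= \tfrac{1}{2} f_{A+B} + \tfrac{7}{40}f^{\mathbf{t}}_{A-B} + \tfrac{1}{40} f^{\mathbf{t}\mathbf{t}}_{A+B} + \tfrac{1}{640} f^{\mathbf{t}\mathbf{t}\mathbf{t}}_{A-B},\\ f^{\mathbf{t}}_{AB} &= -\tfrac{5}{2} f_{A-B} - \tfrac{3}{4} f^{\mathbf{t}}_{A+B} - \tfrac{3}{32} f^{\mathbf{t}\mathbf{t}}_{A-B} - \tfrac{1}{192}f^{\mathbf{t}\mathbf{t}\mathbf{t}}_{A+B},\\ f^{\mathbf{t}\mathbf{t}}_{AB} &= -2f^{\mathbf{t}}_{A-B} - \tfrac12 f^{\mathbf{t}\mathbf{t}}_{A+B} - \tfrac{1}{24} f^{\mathbf{t}\mathbf{t}\mathbf{t}}_{A-B},\\ f^{\mathbf{t}\mathbf{m}}_{AB} &= -2f^{\mathbf{m}}_{A-B} - \tfrac12 f^{\mathbf{t}\mathbf{m}}_{A+B}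 - \tfrac{1}{24} f^{\mathbf{t}\mathbf{t}\mathbf{m}}_{A-B},\\ f^{\mathbf{m}\mathbf{m}}_{AB} &= f^{\mathbf{m}\mathbf{m}}_{AAB + ABB} - \tfrac12 f^{\mathbf{m}\mathbf{m}}_{A+B} - \tfrac{1}{16} f^{\mathbf{t}\mathbf{m}\mathbf{m}}_{A-B},\\ f^{\mathbf{t}\mathbf{t}\mathbf{t}}_{AB} &= 120f_{A-B} + 60f^{\mathbf{t}}_{A+B} + \tfrac{21}{2} f^{\mathbf{t}\mathbf{t}}_{A-B} + \tfrac{3}{4} f^{\mathbf{t}\mathbf{t}\mathbf{t}}_{A+B},\\ f^{\mathbf{t}\mathbf{t}\mathbf{m}}_{AB} &= -48 f^{\mathbf{m}}_{AB} + 24 f^{\mathbf{m}}_{A+B} + 6 f^{\mathbf{t}\mathbf{m}}_{A-B} + \tfrac{1}{2} f^{\mathbf{t}\mathbf{t}\mathbf{m}}_{A+B},\\ f^{\mathbf{t}\mathbf{m}\mathbf{m}}_{AB} &= -8f^{\mathbf{m}\mathbf{m}}_{AAB-ABB} + 4f^{\mathbf{m}\mathbf{m}}_{A-B} + \tfrac12 f^{\mathbf{t}\mathbf{m}\mathbf{m}}_{A+B},\\ f^{\mathbf{m}\mathbf{m}\mathbf{m}}_{AB} &= 45 f_{A+B} + 45 f^{\mathbf{m}}_{A+B} + 36 f^{\mathbf{t}}_{A-B} - \tfrac{217}{16} f^{\mathbf{m}\mathbf{m}}_{A+B} + \tfrac{153}{16} f^{\mathbf{m}\mathbf{t}}_{A-B}\\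 &\quad + \tfrac{567}{64} f^{\mathbf{t}\mathbf{t}}_{A+B} + \tfrac{25}{64} f^{\mathbf{m}\mathbf{m}\mathbf{m}}_{A+B} - \tfrac{251}{128} f^{\mathbf{m}\mathbf{m}\mathbf{t}}_{A-B} + \tfrac{43}{256} f^{\mathbf{m}\mathbf{t}\mathbf{t}}_{A+B} + \tfrac{303}{512} f^{\mathbf{t}\mathbf{t}\mathbf{t}}_{A-B}\\ &\quad - 90 f_C - 24 f^{\mathbf{m}}_C - \tfrac{23}{8} f^{\mathbf{m}\mathbf{m}}_C - \tfrac{135}{32} f^{\mathbf{t}\mathbf{t}}_C - \tfrac{5}{32} f^{\mathbf{m}\mathbf{m}\mathbf{m}}_C - \tfrac{79}{128} f^{\mathbf{m}\mathbf{t}\mathbf{t}}_C\\ &\quad -108 f^{\mathbf{m}}_{AB} + 48 f^{\mathbf{m}_A}_{BC} + 48 f^{\mathbf{m}_B}_{CA}\\ &\quad + 15 f^{\mathbf{m}\mathbf{m}}_{AAB+ABB} -7 f^{\mathbf{m}_A\mathbf{m}_A}_{BBC} + f^{\mathbf{m}_A\mathbf{m}_A}_{BCC} -7 f^{\mathbf{m}_B\mathbf{m}_B}_{CAA} + f^{\mathbf{m}_B\mathbf{m}_B}_{CCA}. \end{align*}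
   Context: 12-split: insert in $T$ its barycenter $(\mathbf{v}_A+\mathbf{v}_B+\mathbf{v}_C)/3$ and the midpoints of the three edges; connect the barycenter by line segments to the three vertices and the three midpoints, and connect the three midpoints pairwise. This divides $T$ into 12 subtriangles. Points: for $X,Y\in\{A,B,C\}$ distinct, the midpoint is $\mathbf{v}_{XY}=(\mathbf{v}_X+\mathbf{v}_Y)/2$, and the quarterpoints are $\mathbf{v}_{XXY}=(3\mathbf{v}_X+\mathbf{v}_Y)/4$ and $\mathbf{v}_{XYY}=(\mathbf{v}_X+3\mathbf{v}_Y)/4$ (so $\mathbf{v}_{AAB},\mathbf{v}_{ABB},\mathbf{v}_{BBC},\mathbf{v}_{BCC},\mathbf{v}_{CCA},\mathbf{v}_{CAA}$, with $\mathbf{v}_{CAA}=(\mathbf{v}_C+3\mathbf{v}_A)/4$). Medial vectors: $\mathbf{m}_X:=\frac12(\mathbf{v}_Y+\mathbf{v}_Z)-\mathbf{v}_X$ for $\{X,Y,Z\}=\{A,B,C\}$. Derivatives: $\nabla_{\mathbf{u}}f(\mathbf{v})=\frac{d}{dt}f(\mathbf{v}+t\mathbf{u})|_{t=0}$ (vectors not normalized; at boundary points of $T$, derivatives are those of the polynomial pieces, i.e. continuous extensions from the interior). A subscript $P$ denotes evaluation at the point $\mathbf{v}_P$, and superscripts denote directional derivatives: $f^{\mathbf{u}_1\cdots\mathbf{u}_k}_P=(\nabla_{\mathbf{u}_1}\cdots\nabla_{\mathbf{u}_k}f)(\mathbf{v}_P)$. Moreover $f^{\mathbf{u}_1\cdots\mathbf{u}_k}_{P\pm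 Q}:=f^{\mathbf{u}_1\cdots\mathbf{u}_k}_P\pm f^{\mathbf{u}_1\cdots\mathbf{u}_k}_Q$. *)

theory Defs
  imports "HOL-Analysis.Analysis"
begin

section \<open>The Powell-Sabin 12-split\<close>

definition triangle_hull :: "real^2 \<Rightarrow> real^2 \<Rightarrow> real^2 \<Rightarrow> (real^2) set" where
  "triangle_hull A B C = convex hull {A, B, C}"

definition barycenter :: "real^2 \<Rightarrow> real^2 \<Rightarrow> real^2 \<Rightarrow> real^2" where
  "barycenter A B C = (1/3) *\<^sub>R (A + B + C)"

definition ps12_segments :: "real^2 \<Rightarrow> real^2 \<Rightarrow> real^2 \<Rightarrow> (real^2) set" where
  "ps12_segments A B C =
     (let G = barycenter A B C; AB = midpoint A B; BC = midpoint B C; CA = midpoint C A in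
        closed_segment G A \<union> closed_segment G B \<union> closed_segment G C \<union>
        closed_segment G AB \<union> closed_segment G BC \<union> closed_segment G CA \<union>
        closed_segment AB BC \<union> closed_segment BC CA \<union> closed_segment CA AB)"

text \<open>
  The segments cut the triangle into pieces; the closures of these pieces are the
  12 (closed) subtriangles.
\<close>

definition ps12_subtriangles :: "real^2 \<Rightarrow> real^2 \<Rightarrow> real^2 \<Rightarrow> (real^2) set set" where
  "ps12_subtriangles A B C = closure ` components (triangle_hull A B C - ps12_segments A B C)"

definition quarterpoint :: "real^2 \<Rightarrow> real^2 \<Rightarrow> real^2" where
  "quarterpoint X Y = (1/4) *\<^sub>R (3 *\<^sub>R X + Y)"

definition medial :: "real^2 \<Rightarrow> real^2 \<Rightarrow> real^2 \<Rightarrow> real^2" where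
  "medial X Y Z = (1/2) *\<^sub>R (Y + Z) - X"

section \<open>Derivatives\<close>

definition dir_deriv :: "'a::real_normed_vector \<Rightarrow> ('a \<Rightarrow> real) \<Rightarrow> 'a \<Rightarrow> real" where
  "dir_deriv u f x = deriv (\<lambda>t. f (x + t *\<^sub>R u)) 0"

text \<open>
  The head of the list is the outermost derivative. The vectors are not normalized.
\<close>

definition dir_derivs :: "'a::real_normed_vector list \<Rightarrow> ('a \<Rightarrow> real) \<Rightarrow> 'a \<Rightarrow> real" where
  "dir_derivs us f = foldr dir_deriv us f"

text \<open>
  Derivatives of a function given on a set \<open>T\<close> with nonempty interior. At boundary points
  they are the continuous extensions from the interior; at interior points, this agrees with
  the derivative itself whenever the latter is continuous. Values of \<open>f\<close> outside \<open>T\<close> are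
  irrelevant.
\<close>

definition derivs_within ::
    "'a::real_normed_vector set \<Rightarrow> 'a list \<Rightarrow> ('a \<Rightarrow> real) \<Rightarrow> 'a \<Rightarrow> real" where
  "derivs_within T us f v = Lim (at v within interior T) (dir_derivs us f)"

primrec Ck_on_open :: "nat \<Rightarrow> 'a::real_normed_vector set \<Rightarrow> ('a \<Rightarrow> real) \<Rightarrow> bool" where
  "Ck_on_open 0 U f \<longleftrightarrow> continuous_on U f"
| "Ck_on_open (Suc k) U f \<longleftrightarrow>
     (\<forall>x\<in>U. f differentiable (at x)) \<and>
     (\<forall>u. Ck_on_open k U (\<lambda>x. frechet_derivative f (at x) u))"

text \<open>
  \<open>C\<^sup>k\<close> on a closed set that is the closure of its interior: \<open>C\<^sup>k\<close> in the interior,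
  with all derivatives up to order \<open>k\<close> extending continuously to the set.
\<close>

definition Ck_on :: "nat \<Rightarrow> 'a::real_normed_vector set \<Rightarrow> ('a \<Rightarrow> real) \<Rightarrow> bool" where
  "Ck_on k T f \<longleftrightarrow>
     continuous_on T f \<and>
     Ck_on_open k (interior T) f \<and>
     (\<forall>us. length us \<le> k \<longrightarrow>
        (\<exists>g. continuous_on T g \<and> (\<forall>x\<in>interior T. g x = dir_derivs us f x)))"

section \<open>Bivariate polynomials\<close>

definition poly_of_degree_le_on :: "nat \<Rightarrow> (real^2) set \<Rightarrow> (real^2 \<Rightarrow> real) \<Rightarrow> bool" where
  "poly_of_degree_le_on d S f \<longleftrightarrow>
     (\<exists>c :: nat \<Rightarrow> nat \<Rightarrow> real. \<forall>x\<in>S. f x = (\<Sum>i\<le>d. \<Sum>j\<le>d - i. c i j * (x $ 1) ^ i * (x $ 2) ^ j))"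

end

theory Submission
  imports Defs
begin

text \<open>
  On each of the twelve subtriangles \<open>f\<close> is a quintic. Two quintics that join with \<open>C\<^sup>3\<close>
  smoothness along an edge differ by \<open>L\<^sup>4 q\<close>, where \<open>L\<close> is an affine form vanishing on the edge
  and the cofactor \<open>q\<close> is affine. The nine interior segments lie on six lines, the medians and
  the lines through two edge midpoints, and the compatibility conditions around the interior
  vertices force the same cofactor along the whole of each line. Hence \<open>f\<close> is the sum of one
  quintic and six truncated powers, with \<open>21 + 6 \<cdot> 3 = 39\<close> parameters. In the affine coordinates
  with origin \<open>v\<^bsub>AB\<^esub>\<close> and axes \<open>t\<close>, \<open>m\<close> each of the nine rules is a linear identity in these
  parameters with rational coefficients.
\<close>

section \<open>Bivariate quintics\<close>

definition quintic :: "(nat \<Rightarrow> nat \<Rightarrow> real) \<Rightarrow> real \<Rightarrow> real \<Rightarrow> real" where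
  "quintic c x y = (\<Sum>i\<le>5. \<Sum>j\<le>5 - i. c i j * x ^ i * y ^ j)"

text \<open>The coefficients of \<open>a\<close> d/dx + \<open>b\<close> d/dy applied to
  \<open>quintic c\<close>. At \<open>i + j = 5\<close> the formula would read entries of total
  degree 6, which \<open>quintic\<close> ignores and which may be arbitrary; setting these values to
  0 keeps the operator exact under iteration.\<close>

definition quintic_deriv ::
    "real \<Rightarrow> real \<Rightarrow> (nat \<Rightarrow> nat \<Rightarrow> real) \<Rightarrow> nat \<Rightarrow> nat \<Rightarrow> real" where
  "quintic_deriv a b c i j =
     (if i + j < 5 then a * (1 + real i) * c (Suc i) j + b * (1 + real j) * c i (Suc j) else 0)"

lemma quintic_expand:
  "quintic c x y =
     c 0 0 + c 0 1 * y + c 0 2 * y^2 + c 0 3 * y^3 + c 0 4 * y^4 + c 0 5 * y^5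
   + x * (c 1 0 + c 1 1 * y + c 1 2 * y^2 + c 1 3 * y^3 + c 1 4 * y^4)
   + x^2 * (c 2 0 + c 2 1 * y + c 2 2 * y^2 + c 2 3 * y^3)
   + x^3 * (c 3 0 + c 3 1 * y + c 3 2 * y^2)
   + x^4 * (c 4 0 + c 4 1 * y)
   + x^5 * c 5 0"
proof -
  have "{..5::nat} = {0,1,2,3,4,5}" "{..4::nat} = {0,1,2,3,4}" "{..3::nat} = {0,1,2,3}"
    "{..2::nat} = {0,1,2}" "{..1::nat} = {0,1}"
    by auto
  then show ?thesis
    by (simp add: quintic_def algebra_simps)
qed

text \<open>Suited to evaluation at concrete points: a vanishing coordinate removes a whole nested
  factor at once, and no powers remain to be normalized.\<close>

lemma quintic_horner:
  "quintic c x y =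
     c 0 0 + y * (c 0 1 + y * (c 0 2 + y * (c 0 3 + y * (c 0 4 + y * c 0 5))))
     + x * (c 1 0 + y * (c 1 1 + y * (c 1 2 + y * (c 1 3 + y * c 1 4)))
     + x * (c 2 0 + y * (c 2 1 + y * (c 2 2 + y * c 2 3))
     + x * (c 3 0 + y * (c 3 1 + y * c 3 2)
     + x * (c 4 0 + y * c 4 1 + x * c 5 0))))"
  unfolding quintic_expand by (simp add: algebra_simps power_numeral_reduce)

lemma quintic_deriv_values:
  "quintic_deriv a b c 0 0 = a * (c 1 0) + b * (c 0 1)"
  "quintic_deriv a b c 0 1 = a * (c 1 1) + b * (2 * c 0 2)"
  "quintic_deriv a b c 0 2 = a * (c 1 2) + b * (3 * c 0 3)"
  "quintic_deriv a b c 0 3 = a * (c 1 3) + b * (4 * c 0 4)"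
  "quintic_deriv a b c 0 4 = a * (c 1 4) + b * (5 * c 0 5)"
  "quintic_deriv a b c 0 5 = 0"
  "quintic_deriv a b c 1 0 = a * (2 * c 2 0) + b * (c 1 1)"
  "quintic_deriv a b c 1 1 = a * (2 * c 2 1) + b * (2 * c 1 2)"
  "quintic_deriv a b c 1 2 = a * (2 * c 2 2) + b * (3 * c 1 3)"
  "quintic_deriv a b c 1 3 = a * (2 * c 2 3) + b * (4 * c 1 4)"
  "quintic_deriv a b c 1 4 = 0"
  "quintic_deriv a b c 2 0 = a * (3 * c 3 0) + b * (c 2 1)"
  "quintic_deriv a b c 2 1 = a * (3 * c 3 1) + b * (2 * c 2 2)"
  "quintic_deriv a b c 2 2 = a * (3 * c 3 2) + b * (3 * c 2 3)"
  "quintic_deriv a b c 2 3 = 0"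
  "quintic_deriv a b c 3 0 = a * (4 * c 4 0) + b * (c 3 1)"
  "quintic_deriv a b c 3 1 = a * (4 * c 4 1) + b * (2 * c 3 2)"
  "quintic_deriv a b c 3 2 = 0"
  "quintic_deriv a b c 4 0 = a * (5 * c 5 0) + b * (c 4 1)"
  "quintic_deriv a b c 4 1 = 0"
  "quintic_deriv a b c 5 0 = 0"
  by (simp_all add: quintic_deriv_def eval_nat_numeral)

lemma quintic_add: "quintic (\<lambda>i j. c i j + d i j) x y = quintic c x y + quintic d x y"
  by (simp add: quintic_def sum.distrib algebra_simps)

lemma quintic_diff: "quintic (\<lambda>i j. c i j - d i j) x y = quintic c x y - quintic d x y"
  by (simp add: quintic_def sum_subtractf algebra_simps)

lemma has_real_derivative_quintic:
  "((\<lambda>s. quintic c (x + s * a) (y + s * b)) has_real_derivative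
      quintic (quintic_deriv a b c) x y) (at 0)"
  unfolding quintic_expand
  apply (rule derivative_eq_intros refl | simp)+
  apply (simp add: quintic_deriv_def numeral_2_eq_2[symmetric])
  apply (simp add: algebra_simps eval_nat_numeral)
  done

section \<open>Directional derivatives in an affine frame\<close>

lemma dir_deriv_frame:
  assumes "\<And>x y. F (P + x *\<^sub>R u + y *\<^sub>R v) = quintic c x y"
  shows "dir_deriv (a *\<^sub>R u + b *\<^sub>R v) F (P + x *\<^sub>R u + y *\<^sub>R v) =
           quintic (quintic_deriv a b c) x y"
proof -
  have "P + x *\<^sub>R u + y *\<^sub>R v + s *\<^sub>R (a *\<^sub>R u + b *\<^sub>R v) =
          P + (x + s * a) *\<^sub>R u + (y + s * b) *\<^sub>R v" for s
    by (simp add: algebra_simps)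
  then show ?thesis
    unfolding dir_deriv_def assms
    by (simp only: assms DERIV_imp_deriv[OF has_real_derivative_quintic])
qed

text \<open>In a fixed frame a direction is a pair of numbers, so repeated differentiation becomes
  iteration of \<open>quintic_deriv\<close> on coefficients. The next derivative needs the formula
  at all points, hence the generalization over \<open>x\<close> and \<open>y\<close>.\<close>

lemma dir_derivs_frame:
  assumes "\<And>x y. F (P + x *\<^sub>R u + y *\<^sub>R v) = quintic c x y"
  shows "dir_derivs (map (\<lambda>(a, b). a *\<^sub>R u + b *\<^sub>R v) ws) F (P + x *\<^sub>R u + y *\<^sub>R v) =
           quintic (foldr (\<lambda>(a, b). quintic_deriv a b) ws c) x y"
proof (induction ws arbitrary: x y)
  case Nil
  then show ?case by (simp add: dir_derivs_def assms)
next
  case (Cons w ws)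
  then show ?case
    by (cases w) (simp add: dir_derivs_def dir_deriv_frame)
qed

section \<open>Affine substitution in polynomials of bounded degree\<close>

inductive bipoly :: "nat \<Rightarrow> (real \<Rightarrow> real \<Rightarrow> real) \<Rightarrow> bool" where
  monom: "i + j \<le> d \<Longrightarrow> bipoly d (\<lambda>x y. x ^ i * y ^ j)"
| scale: "bipoly d F \<Longrightarrow> bipoly d (\<lambda>x y. a * F x y)"
| add: "bipoly d F \<Longrightarrow> bipoly d G \<Longrightarrow> bipoly d (\<lambda>x y. F x y + G x y)"

lemma bipoly_mono: "bipoly d F \<Longrightarrow> d \<le> e \<Longrightarrow> bipoly e F"
  by (induction rule: bipoly.induct) (auto intro: bipoly.intros)

lemma bipoly_sum:
  assumes "finite I" "\<And>i. i \<in> I \<Longrightarrow> bipoly d (F i)"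
  shows "bipoly d (\<lambda>x y. \<Sum>i\<in>I. F i x y)"
  using assms
proof (induction I)
  case empty
  show ?case
    using bipoly.scale[OF bipoly.monom[of 0 0 d], of 0] by simp
next
  case (insert i I)
  then show ?case by (simp add: bipoly.add)
qed

lemma bipoly_affine_mult:
  assumes "bipoly d F"
  shows "bipoly (Suc d) (\<lambda>x y. (p + q * x + r * y) * F x y)"
  using assms
proof (induction rule: bipoly.induct)
  case (monom i j d)
  have "bipoly (Suc d) (\<lambda>x y. p * (x ^ i * y ^ j) + q * (x ^ Suc i * y ^ j) + r * (x ^ i * y ^ Suc j))"
    using monom by (intro bipoly.add bipoly.scale bipoly.monom) auto
  then show ?case by (simp add: algebra_simps)
next
  case (scale d F a)
  from bipoly.scale[OF scale.IH, of a] show ?case by (simp add: algebra_simps)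
next
  case (add d F G)
  from bipoly.add[OF add.IH] show ?case by (simp add: algebra_simps)
qed

lemma bipoly_affine_power_mult:
  "bipoly d F \<Longrightarrow> bipoly (n + d) (\<lambda>x y. (p + q * x + r * y) ^ n * F x y)"
proof (induction n)
  case (Suc n)
  from bipoly_affine_mult[OF Suc.IH[OF Suc.prems], of p q r] show ?case
    by (simp add: mult.assoc)
qed simp

text \<open>Only the existence of coefficients matters: the closure properties of
  \<open>bipoly\<close> handle substitutions, and a coefficient array is extracted once, at the
  end.\<close>

lemma bipoly_imp_quintic:
  assumes "bipoly 5 F"
  shows "\<exists>c. \<forall>x y. F x y = quintic c x y"
proof -
  have "\<exists>c. \<forall>x y. F x y = quintic c x y" if "bipoly d F" "d = 5" for d F
    using that
  proof (induction rule: bipoly.induct)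
    case (monom i j d)
    have "(\<Sum>k\<le>5. \<Sum>l\<le>5 - k. (if k = i \<and> l = j then 1 else 0) * x ^ k * y ^ l) = x ^ i * y ^ j"
      for x y :: real
    proof -
      have "(\<Sum>k\<le>5. \<Sum>l\<le>5 - k. (if k = i \<and> l = j then 1 else 0) * x ^ k * y ^ l) =
              (\<Sum>k\<le>5. if k = i then x ^ i * y ^ j else 0)"
      proof (rule sum.cong)
        fix k :: nat assume "k \<in> {..5}"
        show "(\<Sum>l\<le>5 - k. (if k = i \<and> l = j then 1 else 0) * x ^ k * y ^ l) =
                (if k = i then x ^ i * y ^ j else 0)"
        proof (cases "k = i")
          case True
          then have "(\<Sum>l\<le>5 - k. (if k = i \<and> l = j then 1 else 0) * x ^ k * y ^ l) =
                  (\<Sum>l\<le>5 - k. if l = j then x ^ i * y ^ j else 0)"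
            by (intro sum.cong refl) simp
          with True monom show ?thesis by simp
        qed simp
      qed simp
      also have "\<dots> = x ^ i * y ^ j" using monom by simp
      finally show ?thesis .
    qed
    then show ?case
      unfolding quintic_def by (intro exI[of _ "\<lambda>k l. if k = i \<and> l = j then 1 else 0"]) simp
  next
    case (scale d F a)
    then obtain c where "\<forall>x y. F x y = quintic c x y" by blast
    then have "\<forall>x y. a * F x y = quintic (\<lambda>i j. a * c i j) x y"
      by (simp add: quintic_def sum_distrib_left mult.assoc)
    then show ?case by blast
  next
    case (add d F G)
    then obtain c e where "\<forall>x y. F x y = quintic c x y" "\<forall>x y. G x y = quintic e x y" by blast
    then have "\<forall>x y. F x y + G x y = quintic (\<lambda>i j. c i j + e i j) x y"
      by (simp add: quintic_add)
    then show ?case by blast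
  qed
  with assms show ?thesis by blast
qed

text \<open>Each polynomial piece is continued to the whole plane, so that its derivatives make
  sense on and across the edges of its triangle.\<close>

definition plane_quintic :: "(real^2 \<Rightarrow> real) \<Rightarrow> bool" where
  "plane_quintic F \<longleftrightarrow> (\<exists>c. \<forall>P. F P = quintic c (P $ 1) (P $ 2))"

lemma plane_quintic_frame:
  assumes "plane_quintic F"
  shows "\<exists>c. \<forall>x y. F (P + x *\<^sub>R u + y *\<^sub>R v) = quintic c x y"
proof -
  obtain c where c: "\<And>P. F P = quintic c (P $ 1) (P $ 2)"
    using assms unfolding plane_quintic_def by blast
  \<comment> \<open>The trailing \<open>x ^ 0 * y ^ 0\<close> is the constant 1 written as a
    monomial, which gives the two multiplications by powers of affine forms a \<open>bipoly\<close>
    to start from.\<close>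
  have "bipoly 5 (\<lambda>x y. \<Sum>i\<le>5. \<Sum>j\<le>5 - i. c i j *
          ((P $ 1 + u $ 1 * x + v $ 1 * y) ^ i * ((P $ 2 + u $ 2 * x + v $ 2 * y) ^ j * (x ^ 0 * y ^ 0))))"
  proof (intro bipoly_sum bipoly.scale)
    fix i j :: nat assume "i \<in> {..5}" "j \<in> {..5 - i}"
    then have "i + (j + 0) \<le> 5" by simp
    moreover have "bipoly (i + (j + 0)) (\<lambda>x y. (P $ 1 + u $ 1 * x + v $ 1 * y) ^ i *
        ((P $ 2 + u $ 2 * x + v $ 2 * y) ^ j * (x ^ 0 * y ^ 0)))"
      by (intro bipoly_affine_power_mult bipoly.monom) simp
    ultimately show "bipoly 5 (\<lambda>x y. (P $ 1 + u $ 1 * x + v $ 1 * y) ^ i *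
        ((P $ 2 + u $ 2 * x + v $ 2 * y) ^ j * (x ^ 0 * y ^ 0)))"
      using bipoly_mono by blast
  qed auto
  then have "bipoly 5 (\<lambda>x y. F (P + x *\<^sub>R u + y *\<^sub>R v))"
    by (simp add: c quintic_def algebra_simps)
  from bipoly_imp_quintic[OF this] show ?thesis by blast
qed

lemma continuous_on_quintic: "continuous_on UNIV (\<lambda>P :: real^2. quintic c (P $ 1) (P $ 2))"
  unfolding quintic_expand by (intro continuous_intros)

text \<open>In the frame of the coordinate axes every iterated derivative is again a quintic, hence
  continuous.\<close>

lemma continuous_dir_derivs_plane_quintic:
  assumes "plane_quintic F"
  shows "continuous_on UNIV (dir_derivs us F)"
proof -
  obtain c where c: "\<And>P. F P = quintic c (P $ 1) (P $ 2)"
    using assms unfolding plane_quintic_def by blast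
  let ?e1 = "axis 1 1 :: real^2" and ?e2 = "axis 2 1 :: real^2"
  have e: "P = 0 + P $ 1 *\<^sub>R ?e1 + P $ 2 *\<^sub>R ?e2" for P :: "real^2"
    by (simp add: vec_eq_iff forall_2 axis_def)
  have F: "F (0 + x *\<^sub>R ?e1 + y *\<^sub>R ?e2) = quintic c x y" for x y
    unfolding c by (simp add: axis_def)
  have "\<forall>u\<in>set us. u $ 1 *\<^sub>R ?e1 + u $ 2 *\<^sub>R ?e2 = u"
    by (simp add: vec_eq_iff forall_2 axis_def)
  then have us: "map (\<lambda>(a, b). a *\<^sub>R ?e1 + b *\<^sub>R ?e2) (map (\<lambda>u. (u $ 1, u $ 2)) us) = us"
    by (induction us) auto
  have "dir_derivs us F P =
      quintic (foldr (\<lambda>(a, b). quintic_deriv a b) (map (\<lambda>u. (u $ 1, u $ 2)) us) c) (P $ 1) (P $ 2)" for P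
    using dir_derivs_frame[of F 0 ?e1 ?e2 c "map (\<lambda>u. (u $ 1, u $ 2)) us" "P $ 1" "P $ 2", OF F]
    unfolding us e[symmetric] .
  then show ?thesis
    using continuous_on_quintic by presburger
qed

section \<open>Contact of third order along a segment\<close>

lemma univariate_quintic_zero:
  fixes a :: "nat \<Rightarrow> real"
  assumes "\<And>s. s \<in> {0..1} \<Longrightarrow> (\<Sum>i\<le>5. a i * s ^ i) = 0" "i \<le> 5"
  shows "a i = 0"
proof (rule ccontr)
  assume "a i \<noteq> 0"
  then have "finite {s. (\<Sum>i\<le>5. a i * s ^ i) = 0}"
    using polyfun_finite_roots[of a 5] \<open>i \<le> 5\<close> by blast
  moreover have "{0..1} \<subseteq> {s. (\<Sum>i\<le>5. a i * s ^ i) = 0}"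
    using assms(1) by blast
  ultimately have "finite {0..1::real}"
    by (rule rev_finite_subset)
  then show False using infinite_Icc[of 0 "1::real"] by simp
qed

text \<open>The \<open>k\<close>-th derivative in the second variable, taken at 0, is
  \<open>k!\<close> times the univariate polynomial formed by the coefficients of
  \<open>n ^ k\<close>. Agreement on a segment for \<open>k\<close> up to 3 equates these
  polynomials, so the two quintics can differ only in the monomials \<open>n ^ 4\<close>,
  \<open>s * n ^ 4\<close> and \<open>n ^ 5\<close>.\<close>

lemma quintic_eq_third_order_along_line:
  assumes eq: "\<And>k s. k \<le> 3 \<Longrightarrow> s \<in> {0..1} \<Longrightarrow>
      quintic ((quintic_deriv 0 1 ^^ k) c) s 0 = quintic ((quintic_deriv 0 1 ^^ k) d) s 0"
  shows "\<exists>\<alpha> \<beta> \<gamma>. \<forall>s n. quintic c s n - quintic d s n = n ^ 4 * (\<alpha> + \<beta> * s + \<gamma> * n)"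
proof -
  have sum5: "(\<Sum>i\<le>5. a i * s ^ i) =
      a 0 + a 1 * s + a 2 * s^2 + a 3 * s^3 + a 4 * s^4 + a 5 * s^5" for a :: "nat \<Rightarrow> real" and s
    by (simp add: eval_nat_numeral)
  \<comment> \<open>The coefficients of \<open>n ^ k\<close> form a polynomial of degree at most
    \<open>5 - k\<close>; padding with 0 makes each of them a sum up to 5.\<close>
  define e where "e i j = (if i + j \<le> 5 then c i j - d i j else 0)" for i j
  have zero: "e i k = 0" if "k \<le> 3" "i \<le> 5" for i k
  proof (rule univariate_quintic_zero[OF _ \<open>i \<le> 5\<close>])
    fix s :: real assume s: "s \<in> {0..1}"
    consider "k = 0" | "k = 1" | "k = 2" | "k = 3" using \<open>k \<le> 3\<close> by linarith
    then show "(\<Sum>i\<le>5. e i k * s ^ i) = 0"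
      using eq[OF \<open>k \<le> 3\<close> s]
      by cases (simp_all add: sum5 e_def quintic_expand quintic_deriv_def eval_nat_numeral algebra_simps)
  qed
  have e: "c i j = d i j" if "j \<le> 3" "i + j \<le> 5" for i j
    using zero[of j i] that by (auto simp: e_def)
  have "\<forall>s n. quintic c s n - quintic d s n =
      n ^ 4 * ((c 0 4 - d 0 4) + (c 1 4 - d 1 4) * s + (c 0 5 - d 0 5) * n)"
    unfolding quintic_expand by (simp add: e algebra_simps power_numeral_reduce)
  then show ?thesis by blast
qed

lemma dir_derivs_replicate_frame:
  assumes "\<And>x y. F (P + x *\<^sub>R u + y *\<^sub>R v) = quintic c x y"
  shows "dir_derivs (replicate k v) F (P + x *\<^sub>R u) = quintic ((quintic_deriv 0 1 ^^ k) c) x 0"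
proof -
  have "foldr (\<lambda>(a, b). quintic_deriv a b) (replicate k (0, 1)) c = (quintic_deriv 0 1 ^^ k) c"
    by (induction k) auto
  then show ?thesis
    using dir_derivs_frame[of F P u v c "replicate k (0, 1)" x 0, OF assms] by simp
qed

lemma plane_quintic_diff_fourth_power:
  assumes F: "plane_quintic F" and G: "plane_quintic G"
    and eq: "\<And>k s. k \<le> 3 \<Longrightarrow> s \<in> {0..1} \<Longrightarrow>
      dir_derivs (replicate k v) F (P + s *\<^sub>R u) = dir_derivs (replicate k v) G (P + s *\<^sub>R u)"
  shows "\<exists>\<alpha> \<beta> \<gamma>. \<forall>s n. F (P + s *\<^sub>R u + n *\<^sub>R v) - G (P + s *\<^sub>R u + n *\<^sub>R v) =
           n ^ 4 * (\<alpha> + \<beta> * s + \<gamma> * n)"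
proof -
  obtain c d where c: "\<And>x y. F (P + x *\<^sub>R u + y *\<^sub>R v) = quintic c x y"
    and d: "\<And>x y. G (P + x *\<^sub>R u + y *\<^sub>R v) = quintic d x y"
    using plane_quintic_frame[OF F] plane_quintic_frame[OF G] by meson
  show ?thesis
    unfolding c d
    by (rule quintic_eq_third_order_along_line)
      (metis eq dir_derivs_replicate_frame[of F P u v c, OF c] dir_derivs_replicate_frame[of G P u v d, OF d])
qed

section \<open>Piecewise quintics\<close>

lemma dir_derivs_cong_open:
  assumes "open U" "\<And>x. x \<in> U \<Longrightarrow> f x = g x" "x \<in> U"
  shows "dir_derivs us f x = dir_derivs us g x"
  using \<open>x \<in> U\<close>
proof (induction us arbitrary: x)
  case Nil
  then show ?case by (simp add: dir_derivs_def assms(2))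
next
  case (Cons u us)
  have "((\<lambda>t. x + t *\<^sub>R u) \<longlongrightarrow> x + 0 *\<^sub>R u) (nhds (0::real))"
    by (intro tendsto_intros filterlim_ident)
  then have "\<forall>\<^sub>F t in nhds (0::real). x + t *\<^sub>R u \<in> U"
    using \<open>open U\<close> Cons.prems by (simp add: topological_tendstoD)
  then have "\<forall>\<^sub>F t in nhds (0::real). dir_derivs us f (x + t *\<^sub>R u) = dir_derivs us g (x + t *\<^sub>R u)"
    by eventually_elim (rule Cons.IH)
  then have "deriv (\<lambda>t. dir_derivs us f (x + t *\<^sub>R u)) 0 = deriv (\<lambda>t. dir_derivs us g (x + t *\<^sub>R u)) 0"
    by (rule deriv_cong_ev) simp
  then show ?case by (simp add: dir_derivs_def dir_deriv_def)
qed

text \<open>The continuous extension \<open>g\<close> of the derivative of \<open>f\<close> agrees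
  with the derivative of \<open>F\<close> on the interior of \<open>K\<close>, hence by continuity
  on its closure, which contains \<open>v\<close>. The limit in \<open>derivs_within\<close> runs
  over the whole interior of \<open>T\<close>, not only that of \<open>K\<close>; continuity of
  \<open>g\<close> on \<open>T\<close> shows that it is \<open>g v\<close>.\<close>

lemma derivs_within_piece:
  assumes smooth: "Ck_on k T f" and us: "length us \<le> k"
    and T: "convex T" "closed T"
    and K: "convex K" "interior K \<noteq> {}" "K \<subseteq> T"
    and F: "plane_quintic F" "\<And>x. x \<in> K \<Longrightarrow> f x = F x" and v: "v \<in> K"
  shows "derivs_within T us f v = dir_derivs us F v"
proof -
  obtain g where g: "continuous_on T g" "\<And>x. x \<in> interior T \<Longrightarrow> g x = dir_derivs us f x"
    using smooth us unfolding Ck_on_def by blast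
  have iK: "interior K \<subseteq> interior T" using K by (simp add: interior_mono)
  have cK: "v \<in> closure (interior K)"
    using convex_closure_interior[OF K(1,2)] v closure_subset by blast
  have eq: "g x - dir_derivs us F x = 0" if "x \<in> interior K" for x
  proof -
    have "dir_derivs us f x = dir_derivs us F x"
      using F(2) interior_subset[of K] that by (intro dir_derivs_cong_open[of "interior K"]) auto
    then show ?thesis using g(2)[of x] that iK by auto
  qed
  have "closure (interior K) \<subseteq> T"
    using iK interior_subset[of T] T(2) by (meson closure_minimal order_trans)
  then have "continuous_on (closure (interior K)) (\<lambda>x. g x - dir_derivs us F x)"
    using g(1) continuous_dir_derivs_plane_quintic[OF F(1), of us]
    by (intro continuous_on_diff) (auto intro: continuous_on_subset)
  then have gv: "g v = dir_derivs us F v"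
    using continuous_constant_on_closure[of "interior K" "\<lambda>x. g x - dir_derivs us F x" 0 v] eq cK
    by auto
  have "interior T \<noteq> {}" using K iK by auto
  have "v \<in> T" using v K by blast
  \<comment> \<open>The filter must be nontrivial for the limit to be unique. By convexity every
    point of \<open>T\<close> lies in the closure of its interior.\<close>
  have "v islimpt interior T"
  proof (cases "v \<in> interior T")
    case True
    then show ?thesis by (intro interior_limit_point) simp
  next
    case False
    then show ?thesis
      using convex_closure_interior[OF T(1) \<open>interior T \<noteq> {}\<close>] \<open>v \<in> T\<close> closure_subset[of T]
      unfolding closure_def[of "interior T"] by blast
  qed
  then have nontriv: "\<not> trivial_limit (at v within interior T)"
    by (simp add: trivial_limit_within)
  have "(g \<longlongrightarrow> g v) (at v within interior T)"
    using g(1) \<open>v \<in> T\<close> interior_subset unfolding continuous_on_def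
    by (meson tendsto_within_subset)
  then have "(dir_derivs us f \<longlongrightarrow> g v) (at v within interior T)"
    by (rule Lim_transform_eventually) (simp add: eventually_at_filter g(2))
  then show ?thesis
    unfolding derivs_within_def using tendsto_Lim[OF nontriv] gv by metis
qed

section \<open>Geometry of the 12-split\<close>

definition cross2 :: "real^2 \<Rightarrow> real^2 \<Rightarrow> real" where
  "cross2 u v = u $ 1 * v $ 2 - u $ 2 * v $ 1"

lemma collinear_imp_cross2_eq_0:
  assumes "collinear {X, Y, Z}"
  shows "cross2 (Y - X) (Z - X) = 0"
proof -
  obtain u where "\<And>P Q. P \<in> {X, Y, Z} \<Longrightarrow> Q \<in> {X, Y, Z} \<Longrightarrow> \<exists>c. P - Q = c *\<^sub>R u"
    using assms unfolding collinear_def by blast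
  then obtain a b where "Y - X = a *\<^sub>R u" "Z - X = b *\<^sub>R u"
    by (meson insertI1 insertI2)
  then show ?thesis by (simp add: cross2_def)
qed

lemma cross2_eq_0_imp_collinear:
  assumes "cross2 (Y - X) (Z - X) = 0"
  shows "collinear {X, Y, Z}"
proof (cases "Y = X")
  case True
  then show ?thesis by simp
next
  case False
  define u where "u = Y - X"
  define v where "v = Z - X"
  have "u \<noteq> 0" using False by (simp add: u_def)
  then consider "u $ 1 \<noteq> 0" | "u $ 2 \<noteq> 0" by (auto simp: vec_eq_iff forall_2)
  then have "\<exists>c. v = c *\<^sub>R u"
  proof cases
    case 1
    then have "v = (v $ 1 / u $ 1) *\<^sub>R u"
      using assms by (simp add: vec_eq_iff forall_2 cross2_def u_def[symmetric] v_def[symmetric] field_simps)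
    then show ?thesis by blast
  next
    case 2
    then have "v = (v $ 2 / u $ 2) *\<^sub>R u"
      using assms by (simp add: vec_eq_iff forall_2 cross2_def u_def[symmetric] v_def[symmetric] field_simps)
    then show ?thesis by blast
  qed
  then have "collinear {0, u, v}" by (simp add: collinear_lemma)
  then show ?thesis
    using collinear_3[of Y X Z] by (simp add: u_def v_def insert_commute)
qed

text \<open>This avoids computing the components that define the subtriangles: for a given triangle
  it suffices that its interior is connected and misses the segments.\<close>

lemma exists_component_closure_superset:
  fixes U :: "'a::topological_space set"
  assumes "connected U" "U \<noteq> {}" "U \<subseteq> S"
  shows "\<exists>K\<in>closure ` components S. closure U \<subseteq> K"
proof -
  obtain K where "K \<in> components S" "U \<subseteq> K"
    using exists_component_superset[of U S] assms by auto
  then show ?thesis using closure_mono[of U K] by blast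
qed

text \<open>Read \<open>a\<close>, \<open>b\<close>, \<open>c\<close> as barycentric coordinates and
  \<open>p\<close>, \<open>q\<close>, \<open>r\<close> as the values of an affine form at the
  vertices: a line that has a triangle weakly on one side, without containing all its vertices,
  misses the interior.\<close>

lemma same_sign_combination_nonzero:
  fixes a b c :: real
  assumes "a > 0" "b > 0" "c > 0"
    and "p \<ge> 0 \<and> q \<ge> 0 \<and> r \<ge> 0 \<and> p + q + r > 0 \<or> p \<le> 0 \<and> q \<le> 0 \<and> r \<le> 0 \<and> p + q + r < 0"
  shows "a * p + b * q + c * r \<noteq> 0"
proof -
  have pos: "a * p + b * q + c * r > 0" if "p \<ge> 0" "q \<ge> 0" "r \<ge> 0" "p + q + r > 0" for p q r
  proof -
    have "p > 0 \<or> q > 0 \<or> r > 0" using that by linarith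
    moreover have "a * p \<ge> 0" "b * q \<ge> 0" "c * r \<ge> 0" using that assms by simp_all
    moreover have "p > 0 \<Longrightarrow> a * p > 0" "q > 0 \<Longrightarrow> b * q > 0" "r > 0 \<Longrightarrow> c * r > 0"
      using assms by simp_all
    ultimately show ?thesis by linarith
  qed
  show ?thesis
    using assms(4) pos[of p q r] pos[of "- p" "- q" "- r"] by force
qed

text \<open>
  The three medians and the three lines through two edge midpoints, as the zero sets of
  \<open>l\<^sub>0 + l\<^sub>1 x + l\<^sub>2 y\<close>.
\<close>

definition split_lines :: "(real \<times> real \<times> real) set" where
  "split_lines = {(1, 2, 3), (1, - 2, 3), (0, 1, 0), (0, - 2, 1), (0, 2, 1), (1, 0, 2)}"

definition line_form :: "real \<times> real \<times> real \<Rightarrow> real \<times> real \<Rightarrow> real" where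
  "line_form l p = fst l + fst (snd l) * fst p + snd (snd l) * snd p"

lemma line_form_convex_combination:
  assumes "a + b + c = 1"
  shows "line_form l (a *\<^sub>R p + b *\<^sub>R q + c *\<^sub>R r) = a * line_form l p + b * line_form l q + c * line_form l r"
proof -
  have "line_form l (a *\<^sub>R p + b *\<^sub>R q + c *\<^sub>R r) =
      (a + b + c) * fst l + (line_form l (a *\<^sub>R p + b *\<^sub>R q + c *\<^sub>R r) - fst l)"
    by (simp add: assms)
  then show ?thesis by (simp add: line_form_def algebra_simps)
qed

lemma line_form_diff: "line_form (l - l') p = line_form l p - line_form l' p"
  by (simp add: line_form_def algebra_simps)

section \<open>Affine coordinates adapted to the triangle\<close>

locale ps12_spline =
  fixes A B C :: "real^2" and f :: "real^2 \<Rightarrow> real"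
  assumes nondegenerate: "\<not> collinear {A, B, C}"
    and smooth: "Ck_on 3 (triangle_hull A B C) f"
    and piecewise: "\<forall>K\<in>ps12_subtriangles A B C. poly_of_degree_le_on 5 K f"
begin

abbreviation t where "t \<equiv> B - A"
abbreviation m where "m \<equiv> medial C A B"

text \<open>In this frame every nondegenerate triangle has the vertices (-1/2, 0), (1/2, 0) and (0,
  -1), so all computations take place in one fixed triangle with rational data.\<close>

definition pt :: "real \<times> real \<Rightarrow> real^2" where
  "pt p = midpoint A B + fst p *\<^sub>R t + snd p *\<^sub>R m"

lemma pt_special:
  "pt (- 1/2, 0) = A" "pt (1/2, 0) = B" "pt (0, - 1) = C"
  "pt (0, 0) = midpoint A B" "pt (1/4, - 1/2) = midpoint B C" "pt (- 1/4, - 1/2) = midpoint C A"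
  "pt (- 1/4, 0) = quarterpoint A B" "pt (1/4, 0) = quarterpoint B A"
  "pt (3/8, - 1/4) = quarterpoint B C" "pt (1/8, - 3/4) = quarterpoint C B"
  "pt (- 1/8, - 3/4) = quarterpoint C A" "pt (- 3/8, - 1/4) = quarterpoint A C"
  "pt (0, - 1/3) = barycenter A B C"
  "medial A B C = (3/4) *\<^sub>R t + (- 1/2) *\<^sub>R m" "medial B C A = (- 3/4) *\<^sub>R t + (- 1/2) *\<^sub>R m"
  by (simp_all add: pt_def midpoint_def medial_def quarterpoint_def barycenter_def vec_eq_iff forall_2 field_simps)

lemma cross2_frame_nonzero: "cross2 t m \<noteq> 0"
proof
  assume "cross2 t m = 0"
  \<comment> \<open>Since \<open>m\<close> is half of \<open>B - A\<close> minus
    \<open>C - A\<close>, the two determinants differ only in sign.\<close>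
  then have "cross2 (B - A) (C - A) = 0"
    by (simp add: cross2_def medial_def field_simps)
  then show False
    using cross2_eq_0_imp_collinear nondegenerate by blast
qed

text \<open>Cramer's rule: taking determinants with \<open>m\<close> and with \<open>t\<close>
  isolates each coordinate difference up to the nonzero factor \<open>cross2 t m\<close>.\<close>

lemma pt_inject: "pt p = pt q \<longleftrightarrow> p = q"
proof
  assume "pt p = pt q"
  then have eq: "(fst p - fst q) *\<^sub>R t + (snd p - snd q) *\<^sub>R m = 0"
    by (simp add: pt_def algebra_simps)
  have "(fst p - fst q) * cross2 t m = cross2 ((fst p - fst q) *\<^sub>R t + (snd p - snd q) *\<^sub>R m) m"
    "(snd p - snd q) * cross2 t m = cross2 t ((fst p - fst q) *\<^sub>R t + (snd p - snd q) *\<^sub>R m)"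
    by (simp_all add: cross2_def algebra_simps)
  then show "p = q"
    unfolding eq using cross2_frame_nonzero by (simp add: cross2_def prod_eq_iff)
qed simp

lemma pt_convex_combination:
  assumes "a + b + c = 1"
  shows "a *\<^sub>R pt p + b *\<^sub>R pt q + c *\<^sub>R pt r = pt (a *\<^sub>R p + b *\<^sub>R q + c *\<^sub>R r)"
proof -
  have "a *\<^sub>R pt p + b *\<^sub>R pt q + c *\<^sub>R pt r =
      (a + b + c) *\<^sub>R midpoint A B + fst (a *\<^sub>R p + b *\<^sub>R q + c *\<^sub>R r) *\<^sub>R t
        + snd (a *\<^sub>R p + b *\<^sub>R q + c *\<^sub>R r) *\<^sub>R m"
    unfolding pt_def by (simp add: vec_eq_iff forall_2 algebra_simps)
  then show ?thesis by (simp add: assms pt_def)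
qed

lemma not_collinear_pt:
  assumes "(fst q - fst p) * (snd r - snd p) - (snd q - snd p) * (fst r - fst p) \<noteq> 0"
  shows "\<not> collinear {pt p, pt q, pt r}"
proof
  assume "collinear {pt p, pt q, pt r}"
  then have "cross2 (pt q - pt p) (pt r - pt p) = 0"
    by (rule collinear_imp_cross2_eq_0)
  moreover have "cross2 (pt q - pt p) (pt r - pt p) =
      ((fst q - fst p) * (snd r - snd p) - (snd q - snd p) * (fst r - fst p)) * cross2 t m"
    by (simp add: cross2_def pt_def algebra_simps)
  ultimately show False
    using assms cross2_frame_nonzero by simp
qed

lemma line_form_zero_on_segment:
  assumes "pt z \<in> closed_segment (pt p) (pt q)" "line_form l p = 0" "line_form l q = 0"
  shows "line_form l z = 0"
proof -
  \<comment> \<open>The extra term of weight 0 turns a point of a segment into a combination of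
    three points, the form that the lemmas on convex combinations use.\<close>
  obtain u where "pt z = (1 - u) *\<^sub>R pt p + u *\<^sub>R pt q + 0 *\<^sub>R pt q"
    using assms(1) by (auto simp: in_segment)
  then have "z = (1 - u) *\<^sub>R p + u *\<^sub>R q + 0 *\<^sub>R q"
    using pt_convex_combination[of "1 - u" u 0 p q q] by (simp add: pt_inject)
  then show ?thesis
    using line_form_convex_combination[of "1 - u" u 0 l p q q] assms by simp
qed

lemma on_segments_imp_on_line:
  assumes "pt z \<in> ps12_segments A B C"
  shows "\<exists>l\<in>split_lines. line_form l z = 0"
proof -
  have seg: "\<exists>l\<in>split_lines. line_form l z = 0"
    if "pt z \<in> closed_segment P Q" "P = pt p \<and> Q = pt q" "l \<in> split_lines" "line_form l p = 0 \<and> line_form l q = 0"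
    for P Q p q l
    using line_form_zero_on_segment that by blast
  from assms consider
      "pt z \<in> closed_segment (barycenter A B C) A"
    | "pt z \<in> closed_segment (barycenter A B C) B"
    | "pt z \<in> closed_segment (barycenter A B C) C"
    | "pt z \<in> closed_segment (barycenter A B C) (midpoint A B)"
    | "pt z \<in> closed_segment (barycenter A B C) (midpoint B C)"
    | "pt z \<in> closed_segment (barycenter A B C) (midpoint C A)"
    | "pt z \<in> closed_segment (midpoint A B) (midpoint B C)"
    | "pt z \<in> closed_segment (midpoint B C) (midpoint C A)"
    | "pt z \<in> closed_segment (midpoint C A) (midpoint A B)"
    unfolding ps12_segments_def Let_def by blast
  then show ?thesis
  proof cases
    case 1
    then show ?thesis
      by (rule seg[of _ _ "(0, - 1/3)" "(- 1/2, 0)" "(1, 2, 3)"])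
        (simp only: pt_special simp_thms, simp_all add: split_lines_def line_form_def)
  next
    case 2
    then show ?thesis
      by (rule seg[of _ _ "(0, - 1/3)" "(1/2, 0)" "(1, - 2, 3)"])
        (simp only: pt_special simp_thms, simp_all add: split_lines_def line_form_def)
  next
    case 3
    then show ?thesis
      by (rule seg[of _ _ "(0, - 1/3)" "(0, - 1)" "(0, 1, 0)"])
        (simp only: pt_special simp_thms, simp_all add: split_lines_def line_form_def)
  next
    case 4
    then show ?thesis
      by (rule seg[of _ _ "(0, - 1/3)" "(0, 0)" "(0, 1, 0)"])
        (simp only: pt_special simp_thms, simp_all add: split_lines_def line_form_def)
  next
    case 5
    then show ?thesis
      by (rule seg[of _ _ "(0, - 1/3)" "(1/4, - 1/2)" "(1, 2, 3)"])
        (simp only: pt_special simp_thms, simp_all add: split_lines_def line_form_def)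
  next
    case 6
    then show ?thesis
      by (rule seg[of _ _ "(0, - 1/3)" "(- 1/4, - 1/2)" "(1, - 2, 3)"])
        (simp only: pt_special simp_thms, simp_all add: split_lines_def line_form_def)
  next
    case 7
    then show ?thesis
      by (rule seg[of _ _ "(0, 0)" "(1/4, - 1/2)" "(0, 2, 1)"])
        (simp only: pt_special simp_thms, simp_all add: split_lines_def line_form_def)
  next
    case 8
    then show ?thesis
      by (rule seg[of _ _ "(1/4, - 1/2)" "(- 1/4, - 1/2)" "(1, 0, 2)"])
        (simp only: pt_special simp_thms, simp_all add: split_lines_def line_form_def)
  next
    case 9
    then show ?thesis
      by (rule seg[of _ _ "(- 1/4, - 1/2)" "(0, 0)" "(0, - 2, 1)"])
        (simp only: pt_special simp_thms, simp_all add: split_lines_def line_form_def)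
  qed
qed

lemma pt_in_triangle:
  assumes "y \<le> 0" "2 * x \<le> 1 + y" "- 2 * x \<le> 1 + y"
  shows "pt (x, y) \<in> triangle_hull A B C"
proof -
  \<comment> \<open>The three weights are the barycentric coordinates with respect to
    \<open>A\<close>, \<open>B\<close>, \<open>C\<close>; the hypotheses say that they are
    nonnegative.\<close>
  have "pt (x, y) = ((1 + y) / 2 - x) *\<^sub>R pt (- 1/2, 0) + ((1 + y) / 2 + x) *\<^sub>R pt (1/2, 0) + (- y) *\<^sub>R pt (0, - 1)"
    by (subst pt_convex_combination) (simp_all add: field_simps)
  then show ?thesis
    unfolding triangle_hull_def convex_hull_3 pt_special using assms
    by (intro CollectI exI[of _ "(1 + y) / 2 - x"] exI[of _ "(1 + y) / 2 + x"] exI[of _ "- y"])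
      (simp add: field_simps)
qed

section \<open>Quintic pieces of the spline\<close>

definition piece :: "real \<times> real \<Rightarrow> real \<times> real \<Rightarrow> real \<times> real \<Rightarrow> (real^2 \<Rightarrow> real) \<Rightarrow> bool" where
  "piece p q r F \<longleftrightarrow> plane_quintic F \<and>
     (\<forall>P\<in>convex hull {pt p, pt q, pt r}. f P = F P \<and>
       (\<forall>us. length us \<le> 3 \<longrightarrow> derivs_within (triangle_hull A B C) us f P = dir_derivs us F P))"

text \<open>No split line passes through the interior of the triangle \<open>p q r\<close>, so this
  interior lies in one component of the complement of the segments. The closure of that component
  contains the closed triangle, and \<open>f\<close> is a quintic there; the derivatives up to the
  boundary then come from \<open>derivs_within_piece\<close>.\<close>

lemma exists_piece:
  assumes tri: "\<forall>z\<in>{p, q, r}. snd z \<le> 0 \<and> 2 * fst z \<le> 1 + snd z \<and> - 2 * fst z \<le> 1 + snd z"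
    and det: "(fst q - fst p) * (snd r - snd p) - (snd q - snd p) * (fst r - fst p) \<noteq> 0"
    and sides: "\<forall>l\<in>split_lines.
      line_form l p \<ge> 0 \<and> line_form l q \<ge> 0 \<and> line_form l r \<ge> 0
        \<and> line_form l p + line_form l q + line_form l r > 0 \<or>
      line_form l p \<le> 0 \<and> line_form l q \<le> 0 \<and> line_form l r \<le> 0
        \<and> line_form l p + line_form l q + line_form l r < 0"
  shows "\<exists>F. piece p q r F"
proof -
  let ?T = "triangle_hull A B C"
  define K where "K = convex hull {pt p, pt q, pt r}"
  have intK: "interior K = {P. \<exists>a b c. 0 < a \<and> 0 < b \<and> 0 < c \<and> a + b + c = 1 \<and>
      a *\<^sub>R pt p + b *\<^sub>R pt q + c *\<^sub>R pt r = P}"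
    unfolding K_def by (rule interior_convex_hull_3_minimal[OF not_collinear_pt[OF det]]) simp
  have "(1/3) *\<^sub>R pt p + (1/3) *\<^sub>R pt q + (1/3) *\<^sub>R pt r \<in> interior K"
    unfolding intK by (intro CollectI exI[of _ "1/3"]) simp
  then have ne: "interior K \<noteq> {}" by blast
  have "{pt p, pt q, pt r} \<subseteq> ?T"
    using tri pt_in_triangle[of "snd p" "fst p"] pt_in_triangle[of "snd q" "fst q"]
      pt_in_triangle[of "snd r" "fst r"] by auto
  then have KT: "K \<subseteq> ?T"
    unfolding K_def by (intro hull_minimal) (simp_all add: triangle_hull_def)
  have "interior K \<inter> ps12_segments A B C = {}"
  proof (rule equals0I)
    fix P assume "P \<in> interior K \<inter> ps12_segments A B C"
    then obtain a b c where abc: "0 < a" "0 < b" "0 < c" "a + b + c = 1"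
      and "pt (a *\<^sub>R p + b *\<^sub>R q + c *\<^sub>R r) \<in> ps12_segments A B C"
      unfolding intK using pt_convex_combination[of _ _ _ p q r] by auto
    then obtain l where "l \<in> split_lines" "line_form l (a *\<^sub>R p + b *\<^sub>R q + c *\<^sub>R r) = 0"
      using on_segments_imp_on_line by blast
    then show False
      using same_sign_combination_nonzero[OF abc(1-3) bspec[OF sides]] line_form_convex_combination[OF abc(4)]
      by simp
  qed
  then have "interior K \<subseteq> ?T - ps12_segments A B C"
    using KT interior_subset by blast
  moreover have "connected (interior K)"
    unfolding K_def by (intro convex_connected convex_interior convex_convex_hull)
  ultimately obtain K' where K': "K' \<in> ps12_subtriangles A B C" "closure (interior K) \<subseteq> K'"
    unfolding ps12_subtriangles_def using exists_component_closure_superset[OF _ ne] by metis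
  obtain c :: "nat \<Rightarrow> nat \<Rightarrow> real" where
    c: "\<And>P. P \<in> K' \<Longrightarrow> f P = (\<Sum>i\<le>5. \<Sum>j\<le>5 - i. c i j * (P $ 1) ^ i * (P $ 2) ^ j)"
    using piecewise K'(1) unfolding poly_of_degree_le_on_def by blast
  define F where "F P = quintic c (P $ 1) (P $ 2)" for P :: "real^2"
  have F: "plane_quintic F"
    unfolding plane_quintic_def F_def by blast
  have "convex K" by (simp add: K_def)
  then have "K \<subseteq> K'"
    using K'(2) convex_closure_interior[OF _ ne] closure_subset[of K] by auto
  then have fF: "f P = F P" if "P \<in> K" for P
    using c that unfolding F_def quintic_def by blast
  have T: "convex ?T" "closed ?T"
    by (simp_all add: triangle_hull_def compact_imp_closed finite_imp_compact_convex_hull)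
  have "derivs_within ?T us f P = dir_derivs us F P" if "P \<in> K" "length us \<le> 3" for us P
    using derivs_within_piece[OF smooth that(2) T \<open>convex K\<close> ne KT F fF that(1)] by blast
  with F fF have "piece p q r F"
    unfolding piece_def K_def by blast
  then show ?thesis by blast
qed

lemma piece_plane_quintic: "piece p q r F \<Longrightarrow> plane_quintic F"
  by (simp add: piece_def)

text \<open>On a common edge the derivatives of both quintics up to order 3 are those of
  \<open>f\<close>, so the quintics have third order contact there. Their difference is then the
  fourth power of a transverse coordinate times an affine form, and the frame is chosen so that this
  coordinate is \<open>l\<close> itself.\<close>

lemma adjacent_pieces_diff:
  assumes F: "piece p q r F" and G: "piece p' q' r' G"
    and e: "{e, e'} \<subseteq> {p, q, r} \<inter> {p', q', r'}" "e \<noteq> e'"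
    and l: "line_form l e = 0" "line_form l e' = 0" "snd l \<noteq> (0, 0)"
  shows "\<exists>q. \<forall>z. F (pt z) = G (pt z) + line_form l z ^ 4 * line_form q z"
proof -
  define l1 l2 where "l1 = fst (snd l)" and "l2 = snd (snd l)"
  define N where "N = l1\<^sup>2 + l2\<^sup>2"
  have "N \<noteq> 0" using l(3) by (simp add: N_def l1_def l2_def prod_eq_iff)
  define dx dy where "dx = fst e' - fst e" and "dy = snd e' - snd e"
  define M where "M = dx\<^sup>2 + dy\<^sup>2"
  have "M \<noteq> 0" using e(2) by (auto simp add: M_def dx_def dy_def prod_eq_iff)
  have orth: "l1 * dx + l2 * dy = 0"
    using l(1,2) by (simp add: line_form_def l1_def l2_def dx_def dy_def algebra_simps)
  define u where "u = pt e' - pt e"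
  \<comment> \<open>In frame coordinates this is the gradient of \<open>l\<close> divided by its
    squared length: \<open>l\<close> is constant along \<open>u\<close> and grows at rate 1 along
    \<open>v\<close>.\<close>
  define v where "v = (l1 / N) *\<^sub>R t + (l2 / N) *\<^sub>R m"
  have "dir_derivs (replicate k v) F (pt e + s *\<^sub>R u) = dir_derivs (replicate k v) G (pt e + s *\<^sub>R u)"
    if "k \<le> 3" "s \<in> {0..1}" for k s
  proof -
    have "pt e + s *\<^sub>R u = (1 - s) *\<^sub>R pt e + s *\<^sub>R pt e'"
      by (simp add: u_def algebra_simps)
    then have "pt e + s *\<^sub>R u \<in> closed_segment (pt e) (pt e')"
      using that by (auto simp: in_segment)
    moreover have "closed_segment (pt e) (pt e') \<subseteq> convex hull {pt p, pt q, pt r}"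
      "closed_segment (pt e) (pt e') \<subseteq> convex hull {pt p', pt q', pt r'}"
      unfolding segment_convex_hull using e(1) by (intro hull_mono; auto)+
    ultimately have "pt e + s *\<^sub>R u \<in> convex hull {pt p, pt q, pt r}"
      "pt e + s *\<^sub>R u \<in> convex hull {pt p', pt q', pt r'}" by blast+
    then show ?thesis
      using F G \<open>k \<le> 3\<close> unfolding piece_def by (metis length_replicate)
  qed
  then obtain \<alpha> \<beta> \<gamma> where diff: "\<And>s n. F (pt e + s *\<^sub>R u + n *\<^sub>R v) - G (pt e + s *\<^sub>R u + n *\<^sub>R v) =
      n ^ 4 * (\<alpha> + \<beta> * s + \<gamma> * n)"
    using plane_quintic_diff_fourth_power[of F G v "pt e" u] F G unfolding piece_def by blast
  have "F (pt (x, y)) - G (pt (x, y)) = line_form l (x, y) ^ 4 *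
     ((\<alpha> - \<beta> * (fst e * dx + snd e * dy) / M + \<gamma> * fst l) + (\<beta> * dx / M + \<gamma> * l1) * x + (\<beta> * dy / M + \<gamma> * l2) * y)" for x y
  proof -
    define s where "s = ((x - fst e) * dx + (y - snd e) * dy) / M"
    define n where "n = line_form l (x, y)"
    have n: "n = l1 * (x - fst e) + l2 * (y - snd e)"
      using l(1) by (simp add: n_def line_form_def l1_def l2_def algebra_simps)
    have MN: "M * N = (l1 * dy - l2 * dx)\<^sup>2"
      using orth by (simp add: M_def N_def) algebra
    \<comment> \<open>The vectors \<open>(dx, dy)\<close> and \<open>(l1, l2)\<close> are
      orthogonal, so \<open>s\<close> and \<open>n / N\<close> are the coefficients of two
      orthogonal projections. Multiplying by \<open>M * N\<close> clears the denominators.\<close>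
    have "s * dx + n * l1 / N = x - fst e \<and> s * dy + n * l2 / N = y - snd e"
    proof -
      have "(s * dx + n * l1 / N) * (M * N) = (s * M) * dx * N + n * l1 * M"
        "(s * dy + n * l2 / N) * (M * N) = (s * M) * dy * N + n * l2 * M"
        using \<open>N \<noteq> 0\<close> by (simp_all add: field_simps)
      moreover have "s * M = (x - fst e) * dx + (y - snd e) * dy"
        using \<open>M \<noteq> 0\<close> by (simp add: s_def)
      moreover have "((x - fst e) * dx + (y - snd e) * dy) * dx * N + n * l1 * M = (x - fst e) * (M * N)"
        "((x - fst e) * dx + (y - snd e) * dy) * dy * N + n * l2 * M = (y - snd e) * (M * N)"
        using orth unfolding n M_def N_def by algebra+
      ultimately show ?thesis
        using \<open>M \<noteq> 0\<close> \<open>N \<noteq> 0\<close> by (metis mult_cancel_right mult_eq_0_iff)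
    qed
    then have xy: "x = fst e + s * dx + n * (l1 / N)" "y = snd e + s * dy + n * (l2 / N)" by auto
    have "pt e + s *\<^sub>R u + n *\<^sub>R v = pt (x, y)"
      by (subst xy(1), subst xy(2))
        (simp add: pt_def u_def v_def dx_def dy_def vec_eq_iff forall_2 algebra_simps)
    then have "F (pt (x, y)) - G (pt (x, y)) = n ^ 4 * (\<alpha> + \<beta> * s + \<gamma> * n)"
      using diff[of s n] by simp
    moreover have "\<alpha> + \<beta> * s + \<gamma> * n = (\<alpha> - \<beta> * (fst e * dx + snd e * dy) / M + \<gamma> * fst l)
        + (\<beta> * dx / M + \<gamma> * l1) * x + (\<beta> * dy / M + \<gamma> * l2) * y"
      using \<open>M \<noteq> 0\<close> unfolding s_def n_def line_form_def l1_def l2_def by (simp add: field_simps)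
    ultimately show ?thesis unfolding n_def by simp
  qed
  then show ?thesis
    by (intro exI[of _ "(\<alpha> - \<beta> * (fst e * dx + snd e * dy) / M + \<gamma> * fst l, \<beta> * dx / M + \<gamma> * l1, \<beta> * dy / M + \<gamma> * l2)"])
      (auto simp: line_form_def[of "(_, _)"] diff_eq_eq)
qed

end

section \<open>Truncated power representation\<close>

text \<open>
  A line cannot change its cofactor where it crosses another one. At a midpoint of a medial
  edge this is the coprimality of the two fourth powers; at the barycenter it is the linear
  independence of the nine products of a fourth power of a median form with \<open>1\<close>, \<open>x\<close>, \<open>y\<close>.
\<close>

lemma cofactors_zero_crossing_A:
  assumes eq: "\<And>z. line_form (1, 2, 3) z ^ 4 * line_form q z +
      line_form (0, - 2, 1) z ^ 4 * line_form r z = 0"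
  shows "q = 0 \<and> r = 0"
proof -
  obtain q0 q1 q2 where q: "q = (q0, q1, q2)" by (cases q)
  obtain r0 r1 r2 where r: "r = (r0, r1, r2)" by (cases r)
  \<comment> \<open>Each sample point gives one linear equation in the six unknown coefficients, and
    the six points are chosen so that together they force all of them to vanish.\<close>
  note eqs = eq[of "(0, 0)", unfolded line_form_def q r, simplified]
    eq[of "(- 1, 0)", unfolded line_form_def q r, simplified]
    eq[of "(0, - 1)", unfolded line_form_def q r, simplified]
    eq[of "(0, 1)", unfolded line_form_def q r, simplified]
    eq[of "(1, 0)", unfolded line_form_def q r, simplified]
    eq[of "(- 2, 0)", unfolded line_form_def q r, simplified]
  have "q0 = 0" using eqs by linarith
  moreover have "q1 = 0" using eqs by linarith
  moreover have "q2 = 0" using eqs by linarith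
  moreover have "r0 = 0" using eqs by linarith
  moreover have "r1 = 0" using eqs by linarith
  moreover have "r2 = 0" using eqs by linarith
  ultimately show ?thesis
    by (simp add: q r zero_prod_def)
qed

lemma cofactors_zero_crossing_B:
  assumes eq: "\<And>z. line_form (1, - 2, 3) z ^ 4 * line_form q z +
      line_form (0, 2, 1) z ^ 4 * line_form r z = 0"
  shows "q = 0 \<and> r = 0"
proof -
  obtain q0 q1 q2 where q: "q = (q0, q1, q2)" by (cases q)
  obtain r0 r1 r2 where r: "r = (r0, r1, r2)" by (cases r)
  note eqs = eq[of "(0, 0)", unfolded line_form_def q r, simplified]
    eq[of "(- 1, 0)", unfolded line_form_def q r, simplified]
    eq[of "(0, - 1)", unfolded line_form_def q r, simplified]
    eq[of "(0, 1)", unfolded line_form_def q r, simplified]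
    eq[of "(1, 0)", unfolded line_form_def q r, simplified]
    eq[of "(- 2, 0)", unfolded line_form_def q r, simplified]
  have "q0 = 0" using eqs by linarith
  moreover have "q1 = 0" using eqs by linarith
  moreover have "q2 = 0" using eqs by linarith
  moreover have "r0 = 0" using eqs by linarith
  moreover have "r1 = 0" using eqs by linarith
  moreover have "r2 = 0" using eqs by linarith
  ultimately show ?thesis
    by (simp add: q r zero_prod_def)
qed

lemma cofactors_zero_crossing_C:
  assumes eq: "\<And>z. line_form (0, 1, 0) z ^ 4 * line_form q z +
      line_form (1, 0, 2) z ^ 4 * line_form r z = 0"
  shows "q = 0 \<and> r = 0"
proof -
  obtain q0 q1 q2 where q: "q = (q0, q1, q2)" by (cases q)
  obtain r0 r1 r2 where r: "r = (r0, r1, r2)" by (cases r)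
  note eqs = eq[of "(0, 0)", unfolded line_form_def q r, simplified]
    eq[of "(- 1, 0)", unfolded line_form_def q r, simplified]
    eq[of "(0, - 1)", unfolded line_form_def q r, simplified]
    eq[of "(1, 0)", unfolded line_form_def q r, simplified]
    eq[of "(- 2, 0)", unfolded line_form_def q r, simplified]
    eq[of "(- 1, - 1)", unfolded line_form_def q r, simplified]
  have "q0 = 0" using eqs by linarith
  moreover have "q1 = 0" using eqs by linarith
  moreover have "q2 = 0" using eqs by linarith
  moreover have "r0 = 0" using eqs by linarith
  moreover have "r1 = 0" using eqs by linarith
  moreover have "r2 = 0" using eqs by linarith
  ultimately show ?thesis
    by (simp add: q r zero_prod_def)
qed

lemma cofactors_zero_barycenter:
  assumes eq: "\<And>z. line_form (1, 2, 3) z ^ 4 * line_form q z +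
      line_form (1, - 2, 3) z ^ 4 * line_form r z +
      line_form (0, 1, 0) z ^ 4 * line_form s z = 0"
  shows "q = 0 \<and> r = 0 \<and> s = 0"
proof -
  obtain q0 q1 q2 where q: "q = (q0, q1, q2)" by (cases q)
  obtain r0 r1 r2 where r: "r = (r0, r1, r2)" by (cases r)
  obtain s0 s1 s2 where s: "s = (s0, s1, s2)" by (cases s)
  \<comment> \<open>Here there are nine unknown coefficients, so nine sample points are
    taken.\<close>
  note eqs = eq[of "(0, 0)", unfolded line_form_def q r s, simplified]
    eq[of "(- 1, 0)", unfolded line_form_def q r s, simplified]
    eq[of "(0, - 1)", unfolded line_form_def q r s, simplified]
    eq[of "(1, 0)", unfolded line_form_def q r s, simplified]
    eq[of "(- 2, 0)", unfolded line_form_def q r s, simplified]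
    eq[of "(- 1, - 1)", unfolded line_form_def q r s, simplified]
    eq[of "(- 1, 1)", unfolded line_form_def q r s, simplified]
    eq[of "(1, - 1)", unfolded line_form_def q r s, simplified]
    eq[of "(1, 1)", unfolded line_form_def q r s, simplified]
  have "q0 = 0" using eqs by linarith
  moreover have "q1 = 0" using eqs by linarith
  moreover have "q2 = 0" using eqs by linarith
  moreover have "r0 = 0" using eqs by linarith
  moreover have "r1 = 0" using eqs by linarith
  moreover have "r2 = 0" using eqs by linarith
  moreover have "s0 = 0" using eqs by linarith
  moreover have "s1 = 0" using eqs by linarith
  moreover have "s2 = 0" using eqs by linarith
  ultimately show ?thesis
    by (simp add: q r s zero_prod_def)
qed

text \<open>The multinomial expansion of the fourth power of \<open>line_form l\<close>.\<close>

definition line_power_coeff :: "real \<times> real \<times> real \<Rightarrow> nat \<Rightarrow> nat \<Rightarrow> real" where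
  "line_power_coeff l i j = (if i + j \<le> 4 then fact 4 / (fact i * fact j * fact (4 - (i + j)))
     * fst l ^ (4 - (i + j)) * fst (snd l) ^ i * snd (snd l) ^ j else 0)"

text \<open>Multiplication by the affine cofactor \<open>q\<close> shifts the coefficients of the
  fourth power by one index. The guards at 0 are essential, since \<open>0 - 1 = 0\<close> on
  naturals would otherwise add spurious terms.\<close>

definition fourth_power_coeffs :: "real \<times> real \<times> real \<Rightarrow> real \<times> real \<times> real \<Rightarrow> nat \<Rightarrow> nat \<Rightarrow> real" where
  "fourth_power_coeffs l q i j = fst q * line_power_coeff l i j
     + fst (snd q) * (if i = 0 then 0 else line_power_coeff l (i - 1) j)
     + snd (snd q) * (if j = 0 then 0 else line_power_coeff l i (j - 1))"

text \<open>Powers are written as products, so that for a concrete line the rules for multiplication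
  by 0 and 1 remove the vanishing terms.\<close>

lemma fourth_power_coeffs_values:
  "fourth_power_coeffs (k, l, n) q 0 0 = (k * k * k * k) * fst q"
  "fourth_power_coeffs (k, l, n) q 0 1 = 4 * (k * k * k * n) * fst q + (k * k * k * k) * snd (snd q)"
  "fourth_power_coeffs (k, l, n) q 0 2 = 6 * (k * k * n * n) * fst q + 4 * (k * k * k * n) * snd (snd q)"
  "fourth_power_coeffs (k, l, n) q 0 3 = 4 * (k * n * n * n) * fst q + 6 * (k * k * n * n) * snd (snd q)"
  "fourth_power_coeffs (k, l, n) q 0 4 = (n * n * n * n) * fst q + 4 * (k * n * n * n) * snd (snd q)"
  "fourth_power_coeffs (k, l, n) q 0 5 = (n * n * n * n) * snd (snd q)"
  "fourth_power_coeffs (k, l, n) q 1 0 = 4 * (k * k * k * l) * fst q + (k * k * k * k) * fst (snd q)"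
  "fourth_power_coeffs (k, l, n) q 1 1 = 12 * (k * k * l * n) * fst q + 4 * (k * k * k * n) * fst (snd q) + 4 * (k * k * k * l) * snd (snd q)"
  "fourth_power_coeffs (k, l, n) q 1 2 = 12 * (k * l * n * n) * fst q + 6 * (k * k * n * n) * fst (snd q) + 12 * (k * k * l * n) * snd (snd q)"
  "fourth_power_coeffs (k, l, n) q 1 3 = 4 * (l * n * n * n) * fst q + 4 * (k * n * n * n) * fst (snd q) + 12 * (k * l * n * n) * snd (snd q)"
  "fourth_power_coeffs (k, l, n) q 1 4 = (n * n * n * n) * fst (snd q) + 4 * (l * n * n * n) * snd (snd q)"
  "fourth_power_coeffs (k, l, n) q 2 0 = 6 * (k * k * l * l) * fst q + 4 * (k * k * k * l) * fst (snd q)"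
  "fourth_power_coeffs (k, l, n) q 2 1 = 12 * (k * l * l * n) * fst q + 12 * (k * k * l * n) * fst (snd q) + 6 * (k * k * l * l) * snd (snd q)"
  "fourth_power_coeffs (k, l, n) q 2 2 = 6 * (l * l * n * n) * fst q + 12 * (k * l * n * n) * fst (snd q) + 12 * (k * l * l * n) * snd (snd q)"
  "fourth_power_coeffs (k, l, n) q 2 3 = 4 * (l * n * n * n) * fst (snd q) + 6 * (l * l * n * n) * snd (snd q)"
  "fourth_power_coeffs (k, l, n) q 3 0 = 4 * (k * l * l * l) * fst q + 6 * (k * k * l * l) * fst (snd q)"
  "fourth_power_coeffs (k, l, n) q 3 1 = 4 * (l * l * l * n) * fst q + 12 * (k * l * l * n) * fst (snd q) + 4 * (k * l * l * l) * snd (snd q)"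
  "fourth_power_coeffs (k, l, n) q 3 2 = 6 * (l * l * n * n) * fst (snd q) + 4 * (l * l * l * n) * snd (snd q)"
  "fourth_power_coeffs (k, l, n) q 4 0 = (l * l * l * l) * fst q + 4 * (k * l * l * l) * fst (snd q)"
  "fourth_power_coeffs (k, l, n) q 4 1 = 4 * (l * l * l * n) * fst (snd q) + (l * l * l * l) * snd (snd q)"
  "fourth_power_coeffs (k, l, n) q 5 0 = (l * l * l * l) * fst (snd q)"
  by (simp_all add: fourth_power_coeffs_def line_power_coeff_def fact_numeral eval_nat_numeral)

lemma quintic_fourth_power_coeffs:
  "quintic (fourth_power_coeffs l q) x y = line_form l (x, y) ^ 4 * line_form q (x, y)"
  unfolding quintic_expand fourth_power_coeffs_def line_power_coeff_def line_form_def
  by (simp add: fact_numeral power_numeral_reduce) (simp add: field_simps)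

section \<open>One cofactor for each line\<close>

context ps12_spline
begin

text \<open>Only the six pieces at the corners are recorded, because every point at which the rules
  evaluate \<open>f\<close> lies in one of them. The base quintic is that of \<open>a1\<close>;
  \<open>qA\<close>, \<open>qB\<close>, \<open>qC\<close> are the cofactors of the medians, and
  \<open>rA\<close>, \<open>rB\<close>, \<open>rC\<close> those of the medial edges cutting off the
  corners.\<close>

lemma truncated_power_representation:
  obtains a1 a2 b1 b2 c1 c2 c qA qB qC rA rB rC where
    "piece (- 1/2, 0) (0, 0) (- 1/8, - 1/4) a1" and
    "piece (- 1/2, 0) (- 1/4, - 1/2) (- 1/8, - 1/4) a2" and
    "piece (1/2, 0) (0, 0) (1/8, - 1/4) b1" and
    "piece (1/2, 0) (1/4, - 1/2) (1/8, - 1/4) b2" and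
    "piece (0, - 1) (1/4, - 1/2) (0, - 1/2) c1" and
    "piece (0, - 1) (- 1/4, - 1/2) (0, - 1/2) c2" and
    "\<And>x y. a1 (pt (x, y)) = quintic c x y" and
    "\<And>x y. a2 (pt (x, y)) = quintic (\<lambda>i j. c i j + fourth_power_coeffs (1, 2, 3) qA i j) x y" and
    "\<And>x y. b1 (pt (x, y)) = quintic (\<lambda>i j. c i j
        + fourth_power_coeffs (0, - 2, 1) rA i j + fourth_power_coeffs (0, 1, 0) qC i j
        - fourth_power_coeffs (0, 2, 1) rB i j) x y" and
    "\<And>x y. b2 (pt (x, y)) = quintic (\<lambda>i j. c i j
        + fourth_power_coeffs (0, - 2, 1) rA i j + fourth_power_coeffs (0, 1, 0) qC i j
        + fourth_power_coeffs (1, - 2, 3) qB i j - fourth_power_coeffs (0, 2, 1) rB i j) x y" and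
    "\<And>x y. c1 (pt (x, y)) = quintic (\<lambda>i j. c i j
        + fourth_power_coeffs (0, - 2, 1) rA i j + fourth_power_coeffs (1, 2, 3) qA i j
        + fourth_power_coeffs (1, - 2, 3) qB i j + fourth_power_coeffs (0, 1, 0) qC i j
        - fourth_power_coeffs (1, 0, 2) rC i j) x y" and
    "\<And>x y. c2 (pt (x, y)) = quintic (\<lambda>i j. c i j
        + fourth_power_coeffs (0, - 2, 1) rA i j + fourth_power_coeffs (1, 2, 3) qA i j
        + fourth_power_coeffs (1, - 2, 3) qB i j - fourth_power_coeffs (1, 0, 2) rC i j) x y"
proof -
  let ?lf = line_form
  obtain a1 where a1: "piece (- 1/2, 0) (0, 0) (- 1/8, - 1/4) a1"
    using exists_piece[of "(- 1/2, 0)" "(0, 0)" "(- 1/8, - 1/4)"] by (auto simp: split_lines_def line_form_def)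
  obtain a2 where a2: "piece (- 1/2, 0) (- 1/4, - 1/2) (- 1/8, - 1/4) a2"
    using exists_piece[of "(- 1/2, 0)" "(- 1/4, - 1/2)" "(- 1/8, - 1/4)"] by (auto simp: split_lines_def line_form_def)
  obtain b1 where b1: "piece (1/2, 0) (0, 0) (1/8, - 1/4) b1"
    using exists_piece[of "(1/2, 0)" "(0, 0)" "(1/8, - 1/4)"] by (auto simp: split_lines_def line_form_def)
  obtain b2 where b2: "piece (1/2, 0) (1/4, - 1/2) (1/8, - 1/4) b2"
    using exists_piece[of "(1/2, 0)" "(1/4, - 1/2)" "(1/8, - 1/4)"] by (auto simp: split_lines_def line_form_def)
  obtain c1 where c1: "piece (0, - 1) (1/4, - 1/2) (0, - 1/2) c1"
    using exists_piece[of "(0, - 1)" "(1/4, - 1/2)" "(0, - 1/2)"] by (auto simp: split_lines_def line_form_def)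
  obtain c2 where c2: "piece (0, - 1) (- 1/4, - 1/2) (0, - 1/2) c2"
    using exists_piece[of "(0, - 1)" "(- 1/4, - 1/2)" "(0, - 1/2)"] by (auto simp: split_lines_def line_form_def)
  obtain ia1 where ia1: "piece (0, 0) (- 1/8, - 1/4) (0, - 1/3) ia1"
    using exists_piece[of "(0, 0)" "(- 1/8, - 1/4)" "(0, - 1/3)"] by (auto simp: split_lines_def line_form_def)
  obtain ia2 where ia2: "piece (- 1/4, - 1/2) (- 1/8, - 1/4) (0, - 1/3) ia2"
    using exists_piece[of "(- 1/4, - 1/2)" "(- 1/8, - 1/4)" "(0, - 1/3)"] by (auto simp: split_lines_def line_form_def)
  obtain ib1 where ib1: "piece (0, 0) (1/8, - 1/4) (0, - 1/3) ib1"
    using exists_piece[of "(0, 0)" "(1/8, - 1/4)" "(0, - 1/3)"] by (auto simp: split_lines_def line_form_def)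
  obtain ib2 where ib2: "piece (1/4, - 1/2) (1/8, - 1/4) (0, - 1/3) ib2"
    using exists_piece[of "(1/4, - 1/2)" "(1/8, - 1/4)" "(0, - 1/3)"] by (auto simp: split_lines_def line_form_def)
  obtain ic1 where ic1: "piece (1/4, - 1/2) (0, - 1/2) (0, - 1/3) ic1"
    using exists_piece[of "(1/4, - 1/2)" "(0, - 1/2)" "(0, - 1/3)"] by (auto simp: split_lines_def line_form_def)
  obtain ic2 where ic2: "piece (- 1/4, - 1/2) (0, - 1/2) (0, - 1/3) ic2"
    using exists_piece[of "(- 1/4, - 1/2)" "(0, - 1/2)" "(0, - 1/3)"] by (auto simp: split_lines_def line_form_def)
  \<comment> \<open>One relation for each of the fifteen interior edges follows. Across a medial
    edge the inner piece is always the corner piece plus the fourth power.\<close>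
  have "\<exists>q. \<forall>z. a2 (pt z) = a1 (pt z) + ?lf (1, 2, 3) z ^ 4 * ?lf q z"
    by (rule adjacent_pieces_diff[OF a2 a1, of "(- 1/2, 0)" "(- 1/8, - 1/4)"]) (simp_all add: line_form_def)
  then obtain q1 where q1: "\<And>z. a2 (pt z) = a1 (pt z) + ?lf (1, 2, 3) z ^ 4 * ?lf q1 z" by blast
  have "\<exists>q. \<forall>z. ia1 (pt z) = a1 (pt z) + ?lf (0, - 2, 1) z ^ 4 * ?lf q z"
    by (rule adjacent_pieces_diff[OF ia1 a1, of "(0, 0)" "(- 1/8, - 1/4)"]) (simp_all add: line_form_def)
  then obtain q2 where q2: "\<And>z. ia1 (pt z) = a1 (pt z) + ?lf (0, - 2, 1) z ^ 4 * ?lf q2 z" by blast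
  have "\<exists>q. \<forall>z. ia2 (pt z) = a2 (pt z) + ?lf (0, - 2, 1) z ^ 4 * ?lf q z"
    by (rule adjacent_pieces_diff[OF ia2 a2, of "(- 1/4, - 1/2)" "(- 1/8, - 1/4)"]) (simp_all add: line_form_def)
  then obtain q3 where q3: "\<And>z. ia2 (pt z) = a2 (pt z) + ?lf (0, - 2, 1) z ^ 4 * ?lf q3 z" by blast
  have "\<exists>q. \<forall>z. ia2 (pt z) = ia1 (pt z) + ?lf (1, 2, 3) z ^ 4 * ?lf q z"
    by (rule adjacent_pieces_diff[OF ia2 ia1, of "(- 1/8, - 1/4)" "(0, - 1/3)"]) (simp_all add: line_form_def)
  then obtain q4 where q4: "\<And>z. ia2 (pt z) = ia1 (pt z) + ?lf (1, 2, 3) z ^ 4 * ?lf q4 z" by blast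
  have "\<exists>q. \<forall>z. b2 (pt z) = b1 (pt z) + ?lf (1, - 2, 3) z ^ 4 * ?lf q z"
    by (rule adjacent_pieces_diff[OF b2 b1, of "(1/2, 0)" "(1/8, - 1/4)"]) (simp_all add: line_form_def)
  then obtain q5 where q5: "\<And>z. b2 (pt z) = b1 (pt z) + ?lf (1, - 2, 3) z ^ 4 * ?lf q5 z" by blast
  have "\<exists>q. \<forall>z. ib1 (pt z) = b1 (pt z) + ?lf (0, 2, 1) z ^ 4 * ?lf q z"
    by (rule adjacent_pieces_diff[OF ib1 b1, of "(0, 0)" "(1/8, - 1/4)"]) (simp_all add: line_form_def)
  then obtain q6 where q6: "\<And>z. ib1 (pt z) = b1 (pt z) + ?lf (0, 2, 1) z ^ 4 * ?lf q6 z" by blast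
  have "\<exists>q. \<forall>z. ib2 (pt z) = b2 (pt z) + ?lf (0, 2, 1) z ^ 4 * ?lf q z"
    by (rule adjacent_pieces_diff[OF ib2 b2, of "(1/4, - 1/2)" "(1/8, - 1/4)"]) (simp_all add: line_form_def)
  then obtain q7 where q7: "\<And>z. ib2 (pt z) = b2 (pt z) + ?lf (0, 2, 1) z ^ 4 * ?lf q7 z" by blast
  have "\<exists>q. \<forall>z. ib2 (pt z) = ib1 (pt z) + ?lf (1, - 2, 3) z ^ 4 * ?lf q z"
    by (rule adjacent_pieces_diff[OF ib2 ib1, of "(1/8, - 1/4)" "(0, - 1/3)"]) (simp_all add: line_form_def)
  then obtain q8 where q8: "\<And>z. ib2 (pt z) = ib1 (pt z) + ?lf (1, - 2, 3) z ^ 4 * ?lf q8 z" by blast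
  have "\<exists>q. \<forall>z. c1 (pt z) = c2 (pt z) + ?lf (0, 1, 0) z ^ 4 * ?lf q z"
    by (rule adjacent_pieces_diff[OF c1 c2, of "(0, - 1)" "(0, - 1/2)"]) (simp_all add: line_form_def)
  then obtain q9 where q9: "\<And>z. c1 (pt z) = c2 (pt z) + ?lf (0, 1, 0) z ^ 4 * ?lf q9 z" by blast
  have "\<exists>q. \<forall>z. ic1 (pt z) = c1 (pt z) + ?lf (1, 0, 2) z ^ 4 * ?lf q z"
    by (rule adjacent_pieces_diff[OF ic1 c1, of "(1/4, - 1/2)" "(0, - 1/2)"]) (simp_all add: line_form_def)
  then obtain q10 where q10: "\<And>z. ic1 (pt z) = c1 (pt z) + ?lf (1, 0, 2) z ^ 4 * ?lf q10 z" by blast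
  have "\<exists>q. \<forall>z. ic2 (pt z) = c2 (pt z) + ?lf (1, 0, 2) z ^ 4 * ?lf q z"
    by (rule adjacent_pieces_diff[OF ic2 c2, of "(- 1/4, - 1/2)" "(0, - 1/2)"]) (simp_all add: line_form_def)
  then obtain q11 where q11: "\<And>z. ic2 (pt z) = c2 (pt z) + ?lf (1, 0, 2) z ^ 4 * ?lf q11 z" by blast
  have "\<exists>q. \<forall>z. ic1 (pt z) = ic2 (pt z) + ?lf (0, 1, 0) z ^ 4 * ?lf q z"
    by (rule adjacent_pieces_diff[OF ic1 ic2, of "(0, - 1/2)" "(0, - 1/3)"]) (simp_all add: line_form_def)
  then obtain q12 where q12: "\<And>z. ic1 (pt z) = ic2 (pt z) + ?lf (0, 1, 0) z ^ 4 * ?lf q12 z" by blast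
  have "\<exists>q. \<forall>z. ib1 (pt z) = ia1 (pt z) + ?lf (0, 1, 0) z ^ 4 * ?lf q z"
    by (rule adjacent_pieces_diff[OF ib1 ia1, of "(0, 0)" "(0, - 1/3)"]) (simp_all add: line_form_def)
  then obtain q13 where q13: "\<And>z. ib1 (pt z) = ia1 (pt z) + ?lf (0, 1, 0) z ^ 4 * ?lf q13 z" by blast
  have "\<exists>q. \<forall>z. ic1 (pt z) = ib2 (pt z) + ?lf (1, 2, 3) z ^ 4 * ?lf q z"
    by (rule adjacent_pieces_diff[OF ic1 ib2, of "(1/4, - 1/2)" "(0, - 1/3)"]) (simp_all add: line_form_def)
  then obtain q14 where q14: "\<And>z. ic1 (pt z) = ib2 (pt z) + ?lf (1, 2, 3) z ^ 4 * ?lf q14 z" by blast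
  have "\<exists>q. \<forall>z. ic2 (pt z) = ia2 (pt z) + ?lf (1, - 2, 3) z ^ 4 * ?lf q z"
    by (rule adjacent_pieces_diff[OF ic2 ia2, of "(- 1/4, - 1/2)" "(0, - 1/3)"]) (simp_all add: line_form_def)
  then obtain q15 where q15: "\<And>z. ic2 (pt z) = ia2 (pt z) + ?lf (1, - 2, 3) z ^ 4 * ?lf q15 z" by blast
  \<comment> \<open>The routes from \<open>a1\<close> to \<open>ia2\<close> through
    \<open>a2\<close> and through \<open>ia1\<close> must agree; this compares the two cofactors on
    each line crossing at (-1/8, -1/4). The other two corners are treated alike.\<close>
  have A: "q1 - q4 = 0 \<and> q3 - q2 = 0"
    by (rule cofactors_zero_crossing_A, insert q1 q2 q3 q4) (simp add: line_form_diff algebra_simps)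
  have B: "q5 - q8 = 0 \<and> q7 - q6 = 0"
    by (rule cofactors_zero_crossing_B, insert q5 q6 q7 q8) (simp add: line_form_diff algebra_simps)
  have C: "q9 - q12 = 0 \<and> q10 - q11 = 0"
    by (rule cofactors_zero_crossing_C, insert q9 q10 q11 q12) (simp add: line_form_diff algebra_simps)
  \<comment> \<open>Going once around the barycenter through the six inner pieces crosses each
    median twice, and the jumps must sum to zero.\<close>
  have G: "q14 - q4 = 0 \<and> q8 - q15 = 0 \<and> q13 - q12 = 0"
    by (rule cofactors_zero_barycenter, insert q13 q8 q14 q4 q15 q12) (simp add: line_form_diff algebra_simps)
  obtain c where c: "\<And>x y. a1 (pt (x, y)) = quintic c x y"
    using plane_quintic_frame[OF piece_plane_quintic[OF a1], of "midpoint A B" t m] by (auto simp: pt_def)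
  have same: "q3 = q2" "q4 = q1" "q7 = q6" "q8 = q5" "q11 = q10" "q12 = q9" "q13 = q9" "q14 = q1" "q15 = q5"
    using A B C G by auto
  note diffs = q1 q2 q3[unfolded same] q4[unfolded same] q5 q6 q7[unfolded same] q8[unfolded same] q9 q10
    q11[unfolded same] q12[unfolded same] q13[unfolded same] q14[unfolded same] q15[unfolded same]
  have a2': "a2 (pt z) = a1 (pt z) + ?lf (1, 2, 3) z ^ 4 * ?lf q1 z" for z
    using diffs[of z] by linarith
  \<comment> \<open>The route passes through \<open>ia1\<close> and \<open>ib1\<close>. Entering a
    corner from inside subtracts the fourth power of the medial edge, whence the minus sign; the
    remaining formulas arise in the same way.\<close>
  have b1': "b1 (pt z) = a1 (pt z)
        + ?lf (0, - 2, 1) z ^ 4 * ?lf q2 z + ?lf (0, 1, 0) z ^ 4 * ?lf q9 z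
        - ?lf (0, 2, 1) z ^ 4 * ?lf q6 z" for z
    using diffs[of z] by linarith
  have b2': "b2 (pt z) = a1 (pt z)
        + ?lf (0, - 2, 1) z ^ 4 * ?lf q2 z + ?lf (0, 1, 0) z ^ 4 * ?lf q9 z
        + ?lf (1, - 2, 3) z ^ 4 * ?lf q5 z - ?lf (0, 2, 1) z ^ 4 * ?lf q6 z" for z
    using diffs[of z] by linarith
  have c1': "c1 (pt z) = a1 (pt z)
        + ?lf (0, - 2, 1) z ^ 4 * ?lf q2 z + ?lf (1, 2, 3) z ^ 4 * ?lf q1 z
        + ?lf (1, - 2, 3) z ^ 4 * ?lf q5 z + ?lf (0, 1, 0) z ^ 4 * ?lf q9 z
        - ?lf (1, 0, 2) z ^ 4 * ?lf q10 z" for z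
    using diffs[of z] by linarith
  have c2': "c2 (pt z) = a1 (pt z)
        + ?lf (0, - 2, 1) z ^ 4 * ?lf q2 z + ?lf (1, 2, 3) z ^ 4 * ?lf q1 z
        + ?lf (1, - 2, 3) z ^ 4 * ?lf q5 z - ?lf (1, 0, 2) z ^ 4 * ?lf q10 z" for z
    using diffs[of z] by linarith
  show thesis
    by (rule that[where qA = q1 and qB = q5 and qC = q9 and rA = q2 and rB = q6 and rC = q10, OF a1 a2 b1 b2 c1 c2 c])
      (simp_all only: quintic_add quintic_diff quintic_fourth_power_coeffs c[symmetric] a2' b1' b2' c1' c2')
qed

section \<open>Evaluation of values and derivatives on a piece\<close>

definition dir :: "real \<times> real \<Rightarrow> real^2" where
  "dir w = fst w *\<^sub>R t + snd w *\<^sub>R m"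

lemma dir_special:
  "B - A = dir (1, 0)" "medial C A B = dir (0, 1)"
  "medial A B C = dir (3/4, - 1/2)" "medial B C A = dir (- 3/4, - 1/2)"
  by (simp_all add: dir_def pt_special)

lemma pt_in_hull:
  assumes "a \<ge> 0" "b \<ge> 0" "c \<ge> 0" "a + b + c = 1"
  shows "pt (a *\<^sub>R p + b *\<^sub>R q + c *\<^sub>R r) \<in> convex hull {pt p, pt q, pt r}"
  using assms unfolding convex_hull_3 pt_convex_combination[OF assms(4), symmetric] by blast

text \<open>These act as rewrite rules: once a point is assigned to a piece, the value and the
  derivatives of orders one to three there become explicit expressions in the coefficients.\<close>

lemma derivs_within_on_piece:
  assumes F: "piece p q r F" "\<And>x y. F (pt (x, y)) = quintic c x y"
    and P: "P = pt z" "pt z \<in> convex hull {pt p, pt q, pt r}"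
  shows "f P = quintic c (fst z) (snd z)"
    and "derivs_within (triangle_hull A B C) [dir u] f P =
      quintic (quintic_deriv (fst u) (snd u) c) (fst z) (snd z)"
    and "derivs_within (triangle_hull A B C) [dir u, dir v] f P =
      quintic (quintic_deriv (fst u) (snd u) (quintic_deriv (fst v) (snd v) c)) (fst z) (snd z)"
    and "derivs_within (triangle_hull A B C) [dir u, dir v, dir w] f P =
      quintic (quintic_deriv (fst u) (snd u) (quintic_deriv (fst v) (snd v)
        (quintic_deriv (fst w) (snd w) c))) (fst z) (snd z)"
proof -
  have F': "F (midpoint A B + x *\<^sub>R t + y *\<^sub>R m) = quintic c x y" for x y
    using F(2)[of x y] by (simp add: pt_def)
  have D: "derivs_within (triangle_hull A B C) (map (\<lambda>(a, b). a *\<^sub>R t + b *\<^sub>R m) ws) f P =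
      quintic (foldr (\<lambda>(a, b). quintic_deriv a b) ws c) (fst z) (snd z)" if "length ws \<le> 3" for ws
    using F(1) P that dir_derivs_frame[of F "midpoint A B" t m c ws "fst z" "snd z", OF F']
    by (simp add: piece_def pt_def)
  show "f P = quintic c (fst z) (snd z)"
    using F(1) P F(2)[of "fst z" "snd z"] unfolding piece_def by simp
  show "derivs_within (triangle_hull A B C) [dir u] f P =
      quintic (quintic_deriv (fst u) (snd u) c) (fst z) (snd z)"
    using D[of "[u]"] by (simp add: dir_def split_beta)
  show "derivs_within (triangle_hull A B C) [dir u, dir v] f P =
      quintic (quintic_deriv (fst u) (snd u) (quintic_deriv (fst v) (snd v) c)) (fst z) (snd z)"
    using D[of "[u, v]"] by (simp add: dir_def split_beta)
  show "derivs_within (triangle_hull A B C) [dir u, dir v, dir w] f P =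
      quintic (quintic_deriv (fst u) (snd u) (quintic_deriv (fst v) (snd v)
        (quintic_deriv (fst w) (snd w) c))) (fst z) (snd z)"
    using D[of "[u, v, w]"] by (simp add: dir_def split_beta)
qed

end

section \<open>The nine initialization rules\<close>

theorem mainTheorem2:
  fixes A B C :: "real^2" and f :: "real^2 \<Rightarrow> real"
  assumes nondegenerate: "\<not> collinear {A, B, C}"
    and smooth: "Ck_on 3 (triangle_hull A B C) f"
    and piecewise: "\<forall>K\<in>ps12_subtriangles A B C. poly_of_degree_le_on 5 K f"
  shows
    "let D = (\<lambda>us P. derivs_within (triangle_hull A B C) us f P);
         t = B - A;
         m = medial C A B; mA = medial A B C; mB = medial B C A;
         AB = midpoint A B; BC = midpoint B C; CA = midpoint C A;
         AAB = quarterpoint A B; ABB = quarterpoint B A;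
         BBC = quarterpoint B C; BCC = quarterpoint C B;
         CCA = quarterpoint C A; CAA = quarterpoint A C
     in
       f AB = 1/2 * (f A + f B) + 7/40 * (D [t] A - D [t] B)
              + 1/40 * (D [t,t] A + D [t,t] B) + 1/640 * (D [t,t,t] A - D [t,t,t] B)
     \<and> D [t] AB = - 5/2 * (f A - f B) - 3/4 * (D [t] A + D [t] B)
              - 3/32 * (D [t,t] A - D [t,t] B) - 1/192 * (D [t,t,t] A + D [t,t,t] B)
     \<and> D [t,t] AB = - 2 * (D [t] A - D [t] B) - 1/2 * (D [t,t] A + D [t,t] B)
              - 1/24 * (D [t,t,t] A - D [t,t,t] B)
     \<and> D [t,m] AB = - 2 * (D [m] A - D [m] B) - 1/2 * (D [t,m] A + D [t,m] B)
              - 1/24 * (D [t,t,m] A - D [t,t,m] B)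
     \<and> D [m,m] AB = (D [m,m] AAB + D [m,m] ABB) - 1/2 * (D [m,m] A + D [m,m] B)
              - 1/16 * (D [t,m,m] A - D [t,m,m] B)
     \<and> D [t,t,t] AB = 120 * (f A - f B) + 60 * (D [t] A + D [t] B)
              + 21/2 * (D [t,t] A - D [t,t] B) + 3/4 * (D [t,t,t] A + D [t,t,t] B)
     \<and> D [t,t,m] AB = - 48 * D [m] AB + 24 * (D [m] A + D [m] B)
              + 6 * (D [t,m] A - D [t,m] B) + 1/2 * (D [t,t,m] A + D [t,t,m] B)
     \<and> D [t,m,m] AB = - 8 * (D [m,m] AAB - D [m,m] ABB) + 4 * (D [m,m] A - D [m,m] B)
              + 1/2 * (D [t,m,m] A + D [t,m,m] B)
     \<and> D [m,m,m] AB =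
                45 * (f A + f B) + 45 * (D [m] A + D [m] B) + 36 * (D [t] A - D [t] B)
              - 217/16 * (D [m,m] A + D [m,m] B) + 153/16 * (D [m,t] A - D [m,t] B)
              + 567/64 * (D [t,t] A + D [t,t] B) + 25/64 * (D [m,m,m] A + D [m,m,m] B)
              - 251/128 * (D [m,m,t] A - D [m,m,t] B) + 43/256 * (D [m,t,t] A + D [m,t,t] B)
              + 303/512 * (D [t,t,t] A - D [t,t,t] B)
              - 90 * f C - 24 * D [m] C - 23/8 * D [m,m] C - 135/32 * D [t,t] C
              - 5/32 * D [m,m,m] C - 79/128 * D [m,t,t] C
              - 108 * D [m] AB + 48 * D [mA] BC + 48 * D [mB] CA
              + 15 * (D [m,m] AAB + D [m,m] ABB)
              - 7 * D [mA,mA] BBC + D [mA,mA] BCC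
              - 7 * D [mB,mB] CAA + D [mB,mB] CCA"
proof -
  interpret ps12_spline A B C f
    using assms by unfold_locales
  obtain a1 a2 b1 b2 c1 c2 c qA qB qC rA rB rC where
    a1: "piece (- 1/2, 0) (0, 0) (- 1/8, - 1/4) a1" and
    a2: "piece (- 1/2, 0) (- 1/4, - 1/2) (- 1/8, - 1/4) a2" and
    b1: "piece (1/2, 0) (0, 0) (1/8, - 1/4) b1" and
    b2: "piece (1/2, 0) (1/4, - 1/2) (1/8, - 1/4) b2" and
    c1: "piece (0, - 1) (1/4, - 1/2) (0, - 1/2) c1" and
    c2: "piece (0, - 1) (- 1/4, - 1/2) (0, - 1/2) c2" and
    a1': "\<And>x y. a1 (pt (x, y)) = quintic c x y" and
    a2': "\<And>x y. a2 (pt (x, y)) = quintic (\<lambda>i j. c i j + fourth_power_coeffs (1, 2, 3) qA i j) x y" and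
    b1': "\<And>x y. b1 (pt (x, y)) = quintic (\<lambda>i j. c i j
        + fourth_power_coeffs (0, - 2, 1) rA i j + fourth_power_coeffs (0, 1, 0) qC i j
        - fourth_power_coeffs (0, 2, 1) rB i j) x y" and
    b2': "\<And>x y. b2 (pt (x, y)) = quintic (\<lambda>i j. c i j
        + fourth_power_coeffs (0, - 2, 1) rA i j + fourth_power_coeffs (0, 1, 0) qC i j
        + fourth_power_coeffs (1, - 2, 3) qB i j - fourth_power_coeffs (0, 2, 1) rB i j) x y" and
    c1': "\<And>x y. c1 (pt (x, y)) = quintic (\<lambda>i j. c i j
        + fourth_power_coeffs (0, - 2, 1) rA i j + fourth_power_coeffs (1, 2, 3) qA i j
        + fourth_power_coeffs (1, - 2, 3) qB i j + fourth_power_coeffs (0, 1, 0) qC i j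
        - fourth_power_coeffs (1, 0, 2) rC i j) x y" and
    c2': "\<And>x y. c2 (pt (x, y)) = quintic (\<lambda>i j. c i j
        + fourth_power_coeffs (0, - 2, 1) rA i j + fourth_power_coeffs (1, 2, 3) qA i j
        + fourth_power_coeffs (1, - 2, 3) qB i j - fourth_power_coeffs (1, 0, 2) rC i j) x y"
    by (rule truncated_power_representation) (rule that)
  \<comment> \<open>Each of the twelve evaluation points is placed in a corner piece: vertices and
    edge midpoints are vertices of the piece, while quarterpoints are midpoints of one of its edges,
    whence the weights 1/2.\<close>
  have "pt (- 1/2, 0) \<in> convex hull {pt (- 1/2, 0), pt (0, 0), pt (- 1/8, - 1/4)}"
    using pt_in_hull[of "1" "0" "0" "(- 1/2, 0)" "(0, 0)" "(- 1/8, - 1/4)"] by simp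
  note v1 = derivs_within_on_piece[OF a1 a1' pt_special(1)[symmetric] this, simplified fst_conv snd_conv]
  have "pt (1/2, 0) \<in> convex hull {pt (1/2, 0), pt (0, 0), pt (1/8, - 1/4)}"
    using pt_in_hull[of "1" "0" "0" "(1/2, 0)" "(0, 0)" "(1/8, - 1/4)"] by simp
  note v2 = derivs_within_on_piece[OF b1 b1' pt_special(2)[symmetric] this, simplified fst_conv snd_conv]
  have "pt (0, - 1) \<in> convex hull {pt (0, - 1), pt (1/4, - 1/2), pt (0, - 1/2)}"
    using pt_in_hull[of "1" "0" "0" "(0, - 1)" "(1/4, - 1/2)" "(0, - 1/2)"] by simp
  note v3 = derivs_within_on_piece[OF c1 c1' pt_special(3)[symmetric] this, simplified fst_conv snd_conv]
  have "pt (0, 0) \<in> convex hull {pt (- 1/2, 0), pt (0, 0), pt (- 1/8, - 1/4)}"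
    using pt_in_hull[of "0" "1" "0" "(- 1/2, 0)" "(0, 0)" "(- 1/8, - 1/4)"] by simp
  note v4 = derivs_within_on_piece[OF a1 a1' pt_special(4)[symmetric] this, simplified fst_conv snd_conv]
  have "pt (1/4, - 1/2) \<in> convex hull {pt (1/2, 0), pt (1/4, - 1/2), pt (1/8, - 1/4)}"
    using pt_in_hull[of "0" "1" "0" "(1/2, 0)" "(1/4, - 1/2)" "(1/8, - 1/4)"] by simp
  note v5 = derivs_within_on_piece[OF b2 b2' pt_special(5)[symmetric] this, simplified fst_conv snd_conv]
  have "pt (- 1/4, - 1/2) \<in> convex hull {pt (0, - 1), pt (- 1/4, - 1/2), pt (0, - 1/2)}"
    using pt_in_hull[of "0" "1" "0" "(0, - 1)" "(- 1/4, - 1/2)" "(0, - 1/2)"] by simp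
  note v6 = derivs_within_on_piece[OF c2 c2' pt_special(6)[symmetric] this, simplified fst_conv snd_conv]
  have "pt (- 1/4, 0) \<in> convex hull {pt (- 1/2, 0), pt (0, 0), pt (- 1/8, - 1/4)}"
    using pt_in_hull[of "1/2" "1/2" "0" "(- 1/2, 0)" "(0, 0)" "(- 1/8, - 1/4)"] by simp
  note v7 = derivs_within_on_piece[OF a1 a1' pt_special(7)[symmetric] this, simplified fst_conv snd_conv]
  have "pt (1/4, 0) \<in> convex hull {pt (1/2, 0), pt (0, 0), pt (1/8, - 1/4)}"
    using pt_in_hull[of "1/2" "1/2" "0" "(1/2, 0)" "(0, 0)" "(1/8, - 1/4)"] by simp
  note v8 = derivs_within_on_piece[OF b1 b1' pt_special(8)[symmetric] this, simplified fst_conv snd_conv]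
  have "pt (3/8, - 1/4) \<in> convex hull {pt (1/2, 0), pt (1/4, - 1/2), pt (1/8, - 1/4)}"
    using pt_in_hull[of "1/2" "1/2" "0" "(1/2, 0)" "(1/4, - 1/2)" "(1/8, - 1/4)"] by simp
  note v9 = derivs_within_on_piece[OF b2 b2' pt_special(9)[symmetric] this, simplified fst_conv snd_conv]
  have "pt (1/8, - 3/4) \<in> convex hull {pt (0, - 1), pt (1/4, - 1/2), pt (0, - 1/2)}"
    using pt_in_hull[of "1/2" "1/2" "0" "(0, - 1)" "(1/4, - 1/2)" "(0, - 1/2)"] by simp
  note v10 = derivs_within_on_piece[OF c1 c1' pt_special(10)[symmetric] this, simplified fst_conv snd_conv]
  have "pt (- 1/8, - 3/4) \<in> convex hull {pt (0, - 1), pt (- 1/4, - 1/2), pt (0, - 1/2)}"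
    using pt_in_hull[of "1/2" "1/2" "0" "(0, - 1)" "(- 1/4, - 1/2)" "(0, - 1/2)"] by simp
  note v11 = derivs_within_on_piece[OF c2 c2' pt_special(11)[symmetric] this, simplified fst_conv snd_conv]
  have "pt (- 3/8, - 1/4) \<in> convex hull {pt (- 1/2, 0), pt (- 1/4, - 1/2), pt (- 1/8, - 1/4)}"
    using pt_in_hull[of "1/2" "1/2" "0" "(- 1/2, 0)" "(- 1/4, - 1/2)" "(- 1/8, - 1/4)"] by simp
  note v12 = derivs_within_on_piece[OF a2 a2' pt_special(12)[symmetric] this, simplified fst_conv snd_conv]
  show ?thesis
    \<comment> \<open>All directions become pairs in the frame. After evaluation both sides of each
      rule are linear forms, with rational coefficients, in the 21 entries of \<open>c\<close> and
      the 18 entries of the six cofactors, and the two forms coincide.\<close>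
    unfolding Let_def dir_special
    unfolding v1 v2 v3 v4 v5 v6 v7 v8 v9 v10 v11 v12
      quintic_horner quintic_deriv_values fourth_power_coeffs_values fst_conv snd_conv
      mult_zero_left mult_zero_right add_0_left add_0_right diff_0_right mult_1_left mult_1_right
    by (intro conjI; algebra)
qed

end
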